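(* Let $A=(B,C^s,C^t,\mathcal{B})$ be a dynamic contact algebra with canonical space $A_+$ and $(A_+)^+=(M_A,C^s,C^t,\mathcal{B})$. Then: (i) $(A_+)^+$ is a stable subalgebra of the algebra $RC(A_+)$; (ii) $RC(A_+)$ is a dynamic contact algebra; (iii) the map $g_A$ is a stable isomorphic embedding of $A$ into $RC(A_+)$; (iv) for every time axiom $\varphi$ among (rs), (ls), (up dir), (down dir), (circ), (dens), (ref), (lin), (tri), (tr), $\varphi$ is true in $A$ iff $\varphi$ is true in $RC(A_+)$.
   Context: DCA: $B$ Boolean algebra, $0\neq1$; $C^s,C^t$ contact relations, $\mathcal{B}$ precontact (precontact: $aCb\Rightarrow a,b\neq0$, upward monotone, $aC(b+c)\Rightarrow aCb\vee aCc$, $(a+b)Cc\Rightarrow aCc\vee bCc$; contact: also symmetric and $a\cdot b\neq0\Rightarrow aCb$); $aC^sb\Rightarrow aC^tb$; $a\overline{C^t}b\Rightarrow\exists c(a\overline{C^t}c\wedge c^*\overline{C^t}b)$; $a\overline{\mathcal{B}}b\Rightarrow\exists c(a\overline{C^t}c\wedge c^*\overline{\mathcal{B}}b)$; $a\overline{\mathcal{B}}b\Rightarrow\exists c(a\overline{\mathcal{B}}c\wedge c^*\overline{C^t}b)$. t-clans/s-clans: $\Gamma\subseteq B$ with $1\in\Gamma,0\notin\Gamma$, upward closed, prime ($a+b\in\Gamma\Rightarrow a\in\Gamma\vee b\in\Gamma$), pairwise $C^t$-/$C^s$-related; clusters: t-clans with $\forall a\notin\Gamma\exists b\in\Gamma\,a\overline{C^t}b$.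 Canonical space $A_+$: points $X^t_A$ = t-clans, $X^s_A$ = s-clans, $T_A$ = clusters; $\Gamma\prec_A\Delta$ iff $a\mathcal{B}b$ for all $a\in\Gamma,b\in\Delta$; $g_A(a)=\{\Gamma\in X^t_A:a\in\Gamma\}$; $M_A=\{g_A(a):a\in B\}$ taken as a closed base of a topology on $X^t_A$. $RC(A_+)$ is the Boolean algebra of regular closed subsets of $X^t_A$ ($a+b=a\cup b$, $a\cdot b=Cl\,Int(a\cap b)$, $a^*=Cl(X^t_A\setminus a)$) with $aC^tb$ iff $a\cap b\neq\emptyset$, $aC^sb$ iff $a\cap b\cap X^s_A\neq\emptyset$, $a\mathcal{B}b$ iff $\exists x\in a,y\in b\,(x\prec_Ay)$; $(A_+)^+$ is its restriction to $M_A$. Stable subalgebra $A_1\subseteq A_2$: every nonzero $a_2$ has nonzero $a_1\in A_1$ with $a_1\le a_2$, and for each $C\in\{C^s,C^t,\mathcal{B}\}$, $a_2\overline{C}b_2$ implies $\exists a_1,b_1\in A_1$ with $a_1\overline{C}b_1$, $a_2\le a_1$, $b_2\le b_1$; a stable isomorphic embedding is an injective Boolean homomorphism preserving and reflecting $C^s,C^t,\mathcal{B}$ whose image is a stable subalgebra. Time axioms: (rs) $a\neq0\Rightarrow a\mathcal{B}1$; (ls) $a\neq0\Rightarrow1\mathcal{B}a$; (up dir) $a,b\neq0\Rightarrow a\mathcal{B}p\vee b\mathcal{B}p^*$; (down dir) $a,b\neq0\Rightarrow p\mathcal{B}a\vee p^*\mathcal{B}b$; (circ) $a\mathcal{B}b\Rightarrow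 b\mathcal{B}p\vee p^*\mathcal{B}a$; (dens) $a\mathcal{B}b\Rightarrow a\mathcal{B}p\vee p^*\mathcal{B}b$; (ref) $aC^tb\Rightarrow a\mathcal{B}b$; (lin) $a,b\neq0\Rightarrow a\mathcal{B}b\vee b\mathcal{B}a$; (tri) $a,b\neq0\Rightarrow aC^tb\vee a\mathcal{B}b\vee b\mathcal{B}a$; (tr) $a\overline{\mathcal{B}}b\Rightarrow\exists c(a\overline{\mathcal{B}}c\wedge c^*\overline{\mathcal{B}}b)$; all universally quantified. *)

theory Defs
  imports "HOL-Analysis.Abstract_Topology"
begin

section \<open>Dynamic contact algebras\<close>

text \<open>
  Algebras have an explicit carrier, because the algebra of regular closed sets of a
  topological space is not a whole type. Operations and relations are only meaningful on
  the carrier.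
\<close>

record 'a dca =
  elems :: "'a set"
  join :: "'a \<Rightarrow> 'a \<Rightarrow> 'a" (infixl "\<oplus>\<index>" 65)
  meet :: "'a \<Rightarrow> 'a \<Rightarrow> 'a" (infixl "\<odot>\<index>" 70)
  compl :: "'a \<Rightarrow> 'a"
  zero :: "'a" ("\<zero>\<index>")
  one :: "'a" ("\<one>\<index>")
  space_contact :: "'a \<Rightarrow> 'a \<Rightarrow> bool"
  time_contact :: "'a \<Rightarrow> 'a \<Rightarrow> bool"
  precedence :: "'a \<Rightarrow> 'a \<Rightarrow> bool"

definition below :: "'a dca \<Rightarrow> 'a \<Rightarrow> 'a \<Rightarrow> bool" where
  "below A a b \<longleftrightarrow> join A a b = b"

locale nontrivial_boolean_algebra =
  fixes A :: "'a dca" (structure)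
  assumes join_closed: "\<lbrakk>a \<in> elems A; b \<in> elems A\<rbrakk> \<Longrightarrow> a \<oplus> b \<in> elems A"
    and meet_closed: "\<lbrakk>a \<in> elems A; b \<in> elems A\<rbrakk> \<Longrightarrow> a \<odot> b \<in> elems A"
    and compl_closed: "a \<in> elems A \<Longrightarrow> compl A a \<in> elems A"
    and zero_closed: "\<zero> \<in> elems A"
    and one_closed: "\<one> \<in> elems A"
    and join_assoc: "\<lbrakk>a \<in> elems A; b \<in> elems A; c \<in> elems A\<rbrakk> \<Longrightarrow> (a \<oplus> b) \<oplus> c = a \<oplus> (b \<oplus> c)"
    and meet_assoc: "\<lbrakk>a \<in> elems A; b \<in> elems A; c \<in> elems A\<rbrakk> \<Longrightarrow> (a \<odot> b) \<odot> c = a \<odot> (b \<odot> c)"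
    and join_comm: "\<lbrakk>a \<in> elems A; b \<in> elems A\<rbrakk> \<Longrightarrow> a \<oplus> b = b \<oplus> a"
    and meet_comm: "\<lbrakk>a \<in> elems A; b \<in> elems A\<rbrakk> \<Longrightarrow> a \<odot> b = b \<odot> a"
    and join_absorb: "\<lbrakk>a \<in> elems A; b \<in> elems A\<rbrakk> \<Longrightarrow> a \<oplus> (a \<odot> b) = a"
    and meet_absorb: "\<lbrakk>a \<in> elems A; b \<in> elems A\<rbrakk> \<Longrightarrow> a \<odot> (a \<oplus> b) = a"
    and meet_distrib:
      "\<lbrakk>a \<in> elems A; b \<in> elems A; c \<in> elems A\<rbrakk> \<Longrightarrow> a \<odot> (b \<oplus> c) = (a \<odot> b) \<oplus> (a \<odot> c)"
    and join_compl: "a \<in> elems A \<Longrightarrow> a \<oplus> compl A a = \<one>"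
    and meet_compl: "a \<in> elems A \<Longrightarrow> a \<odot> compl A a = \<zero>"
    and zero_neq_one: "\<zero> \<noteq> \<one>"

locale precontact_relation =
  fixes A :: "'a dca" (structure) and C :: "'a \<Rightarrow> 'a \<Rightarrow> bool"
  assumes nonzero: "\<lbrakk>a \<in> elems A; b \<in> elems A; C a b\<rbrakk> \<Longrightarrow> a \<noteq> \<zero> \<and> b \<noteq> \<zero>"
    and upward_monotone:
      "\<lbrakk>a \<in> elems A; b \<in> elems A; a' \<in> elems A; b' \<in> elems A; C a b; below A a a'; below A b b'\<rbrakk>
        \<Longrightarrow> C a' b'"
    and join_right:
      "\<lbrakk>a \<in> elems A; b \<in> elems A; c \<in> elems A; C a (b \<oplus> c)\<rbrakk> \<Longrightarrow> C a b \<or> C a c"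
    and join_left:
      "\<lbrakk>a \<in> elems A; b \<in> elems A; c \<in> elems A; C (a \<oplus> b) c\<rbrakk> \<Longrightarrow> C a c \<or> C b c"

locale contact_relation = precontact_relation +
  assumes symmetric: "\<lbrakk>a \<in> elems A; b \<in> elems A; C a b\<rbrakk> \<Longrightarrow> C b a"
    and overlap: "\<lbrakk>a \<in> elems A; b \<in> elems A; a \<odot> b \<noteq> \<zero>\<rbrakk> \<Longrightarrow> C a b"

locale dynamic_contact_algebra = nontrivial_boolean_algebra +
  assumes space_contact: "contact_relation A (space_contact A)"
    and time_contact: "contact_relation A (time_contact A)"
    and precedence: "precontact_relation A (precedence A)"
    and space_imp_time:
      "\<lbrakk>a \<in> elems A; b \<in> elems A; space_contact A a b\<rbrakk> \<Longrightarrow> time_contact A a b"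
    and time_interpolation:
      "\<lbrakk>a \<in> elems A; b \<in> elems A; \<not> time_contact A a b\<rbrakk>
        \<Longrightarrow> \<exists>c\<in>elems A. \<not> time_contact A a c \<and> \<not> time_contact A (compl A c) b"
    and time_precedence_interpolation:
      "\<lbrakk>a \<in> elems A; b \<in> elems A; \<not> precedence A a b\<rbrakk>
        \<Longrightarrow> \<exists>c\<in>elems A. \<not> time_contact A a c \<and> \<not> precedence A (compl A c) b"
    and precedence_time_interpolation:
      "\<lbrakk>a \<in> elems A; b \<in> elems A; \<not> precedence A a b\<rbrakk>
        \<Longrightarrow> \<exists>c\<in>elems A. \<not> precedence A a c \<and> \<not> time_contact A (compl A c) b"


section \<open>Subalgebras and embeddings\<close>

definition subalgebra :: "'a dca \<Rightarrow> 'a dca \<Rightarrow> bool" where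
  "subalgebra A\<^sub>1 A\<^sub>2 \<longleftrightarrow>
     elems A\<^sub>1 \<subseteq> elems A\<^sub>2 \<and>
     zero A\<^sub>1 \<in> elems A\<^sub>1 \<and> zero A\<^sub>1 = zero A\<^sub>2 \<and>
     one A\<^sub>1 \<in> elems A\<^sub>1 \<and> one A\<^sub>1 = one A\<^sub>2 \<and>
     (\<forall>a\<in>elems A\<^sub>1. compl A\<^sub>1 a \<in> elems A\<^sub>1 \<and> compl A\<^sub>1 a = compl A\<^sub>2 a) \<and>
     (\<forall>a\<in>elems A\<^sub>1. \<forall>b\<in>elems A\<^sub>1.
        join A\<^sub>1 a b \<in> elems A\<^sub>1 \<and> join A\<^sub>1 a b = join A\<^sub>2 a b \<and>
        meet A\<^sub>1 a b \<in> elems A\<^sub>1 \<and> meet A\<^sub>1 a b = meet A\<^sub>2 a b \<and>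
        space_contact A\<^sub>1 a b = space_contact A\<^sub>2 a b \<and>
        time_contact A\<^sub>1 a b = time_contact A\<^sub>2 a b \<and>
        precedence A\<^sub>1 a b = precedence A\<^sub>2 a b)"

definition stable_subalgebra :: "'a dca \<Rightarrow> 'a dca \<Rightarrow> bool" where
  "stable_subalgebra A\<^sub>1 A\<^sub>2 \<longleftrightarrow>
     subalgebra A\<^sub>1 A\<^sub>2 \<and>
     (\<forall>a\<^sub>2\<in>elems A\<^sub>2. a\<^sub>2 \<noteq> zero A\<^sub>2 \<longrightarrow>
        (\<exists>a\<^sub>1\<in>elems A\<^sub>1. a\<^sub>1 \<noteq> zero A\<^sub>1 \<and> below A\<^sub>2 a\<^sub>1 a\<^sub>2)) \<and>
     (\<forall>C\<in>{space_contact, time_contact, precedence}.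
        \<forall>a\<^sub>2\<in>elems A\<^sub>2. \<forall>b\<^sub>2\<in>elems A\<^sub>2. \<not> C A\<^sub>2 a\<^sub>2 b\<^sub>2 \<longrightarrow>
          (\<exists>a\<^sub>1\<in>elems A\<^sub>1. \<exists>b\<^sub>1\<in>elems A\<^sub>1.
             \<not> C A\<^sub>1 a\<^sub>1 b\<^sub>1 \<and> below A\<^sub>2 a\<^sub>2 a\<^sub>1 \<and> below A\<^sub>2 b\<^sub>2 b\<^sub>1))"

definition restrict_dca :: "'a dca \<Rightarrow> 'a set \<Rightarrow> 'a dca" where
  "restrict_dca A S = A\<lparr>elems := S\<rparr>"

definition boolean_homomorphism :: "('a \<Rightarrow> 'b) \<Rightarrow> 'a dca \<Rightarrow> 'b dca \<Rightarrow> bool" where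
  "boolean_homomorphism h A\<^sub>1 A\<^sub>2 \<longleftrightarrow>
     h ` elems A\<^sub>1 \<subseteq> elems A\<^sub>2 \<and>
     h (zero A\<^sub>1) = zero A\<^sub>2 \<and>
     h (one A\<^sub>1) = one A\<^sub>2 \<and>
     (\<forall>a\<in>elems A\<^sub>1. h (compl A\<^sub>1 a) = compl A\<^sub>2 (h a)) \<and>
     (\<forall>a\<in>elems A\<^sub>1. \<forall>b\<in>elems A\<^sub>1.
        h (join A\<^sub>1 a b) = join A\<^sub>2 (h a) (h b) \<and>
        h (meet A\<^sub>1 a b) = meet A\<^sub>2 (h a) (h b))"

definition stable_isomorphic_embedding :: "('a \<Rightarrow> 'b) \<Rightarrow> 'a dca \<Rightarrow> 'b dca \<Rightarrow> bool" where
  "stable_isomorphic_embedding h A\<^sub>1 A\<^sub>2 \<longleftrightarrow>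
     boolean_homomorphism h A\<^sub>1 A\<^sub>2 \<and>
     inj_on h (elems A\<^sub>1) \<and>
     (\<forall>a\<in>elems A\<^sub>1. \<forall>b\<in>elems A\<^sub>1.
        (space_contact A\<^sub>1 a b \<longleftrightarrow> space_contact A\<^sub>2 (h a) (h b)) \<and>
        (time_contact A\<^sub>1 a b \<longleftrightarrow> time_contact A\<^sub>2 (h a) (h b)) \<and>
        (precedence A\<^sub>1 a b \<longleftrightarrow> precedence A\<^sub>2 (h a) (h b))) \<and>
     stable_subalgebra (restrict_dca A\<^sub>2 (h ` elems A\<^sub>1)) A\<^sub>2"


section \<open>Time axioms\<close>

datatype time_axiom = RS | LS | Up_Dir | Down_Dir | Circ | Dens | Ref | Lin | Tri | Tr

primrec holds :: "'a dca \<Rightarrow> time_axiom \<Rightarrow> bool" where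
  "holds A RS \<longleftrightarrow> (\<forall>a\<in>elems A. a \<noteq> zero A \<longrightarrow> precedence A a (one A))"
| "holds A LS \<longleftrightarrow> (\<forall>a\<in>elems A. a \<noteq> zero A \<longrightarrow> precedence A (one A) a)"
| "holds A Up_Dir \<longleftrightarrow>
     (\<forall>a\<in>elems A. \<forall>b\<in>elems A. \<forall>p\<in>elems A. a \<noteq> zero A \<and> b \<noteq> zero A \<longrightarrow>
        precedence A a p \<or> precedence A b (compl A p))"
| "holds A Down_Dir \<longleftrightarrow>
     (\<forall>a\<in>elems A. \<forall>b\<in>elems A. \<forall>p\<in>elems A. a \<noteq> zero A \<and> b \<noteq> zero A \<longrightarrow>
        precedence A p a \<or> precedence A (compl A p) b)"
| "holds A Circ \<longleftrightarrow>
     (\<forall>a\<in>elems A. \<forall>b\<in>elems A. \<forall>p\<in>elems A. precedence A a b \<longrightarrow>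
        precedence A b p \<or> precedence A (compl A p) a)"
| "holds A Dens \<longleftrightarrow>
     (\<forall>a\<in>elems A. \<forall>b\<in>elems A. \<forall>p\<in>elems A. precedence A a b \<longrightarrow>
        precedence A a p \<or> precedence A (compl A p) b)"
| "holds A Ref \<longleftrightarrow>
     (\<forall>a\<in>elems A. \<forall>b\<in>elems A. time_contact A a b \<longrightarrow> precedence A a b)"
| "holds A Lin \<longleftrightarrow>
     (\<forall>a\<in>elems A. \<forall>b\<in>elems A. a \<noteq> zero A \<and> b \<noteq> zero A \<longrightarrow>
        precedence A a b \<or> precedence A b a)"
| "holds A Tri \<longleftrightarrow>
     (\<forall>a\<in>elems A. \<forall>b\<in>elems A. a \<noteq> zero A \<and> b \<noteq> zero A \<longrightarrow>
        time_contact A a b \<or> precedence A a b \<or> precedence A b a)"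
| "holds A Tr \<longleftrightarrow>
     (\<forall>a\<in>elems A. \<forall>b\<in>elems A. \<not> precedence A a b \<longrightarrow>
        (\<exists>c\<in>elems A. \<not> precedence A a c \<and> \<not> precedence A (compl A c) b))"


section \<open>Clans, clusters and the canonical space\<close>

definition clan :: "'a dca \<Rightarrow> ('a \<Rightarrow> 'a \<Rightarrow> bool) \<Rightarrow> 'a set \<Rightarrow> bool" where
  "clan A C \<Gamma> \<longleftrightarrow>
     \<Gamma> \<subseteq> elems A \<and> one A \<in> \<Gamma> \<and> zero A \<notin> \<Gamma> \<and>
     (\<forall>a\<in>\<Gamma>. \<forall>b\<in>elems A. below A a b \<longrightarrow> b \<in> \<Gamma>) \<and>
     (\<forall>a\<in>elems A. \<forall>b\<in>elems A. join A a b \<in> \<Gamma> \<longrightarrow> a \<in> \<Gamma> \<or> b \<in> \<Gamma>) \<and>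
     (\<forall>a\<in>\<Gamma>. \<forall>b\<in>\<Gamma>. C a b)"

definition t_clans :: "'a dca \<Rightarrow> 'a set set" where
  "t_clans A = {\<Gamma>. clan A (time_contact A) \<Gamma>}"

definition s_clans :: "'a dca \<Rightarrow> 'a set set" where
  "s_clans A = {\<Gamma>. clan A (space_contact A) \<Gamma>}"

definition clusters :: "'a dca \<Rightarrow> 'a set set" where
  "clusters A =
     {\<Gamma> \<in> t_clans A. \<forall>a\<in>elems A. a \<notin> \<Gamma> \<longrightarrow> (\<exists>b\<in>\<Gamma>. \<not> time_contact A a b)}"

definition g_map :: "'a dca \<Rightarrow> 'a \<Rightarrow> 'a set set" where
  "g_map A a = {\<Gamma> \<in> t_clans A. a \<in> \<Gamma>}"

text \<open>
  The topology on \<open>X\<close> whose closed sets are the intersections of subfamilies of \<open>M\<close>;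
  its open sets are the unions of complements of members of \<open>M\<close>.
\<close>

definition closed_base_topology :: "'p set \<Rightarrow> 'p set set \<Rightarrow> 'p topology" where
  "closed_base_topology X M = topology (arbitrary union_of (\<lambda>U. \<exists>m\<in>M. U = X - m))"

record 'p dynamic_space =
  space_topology :: "'p topology"
  space_points :: "'p set"
  time_points :: "'p set"
  point_before :: "'p \<Rightarrow> 'p \<Rightarrow> bool"
  closed_base :: "'p set set"

definition canonical_space :: "'a dca \<Rightarrow> 'a set dynamic_space" where
  "canonical_space A =
     \<lparr> space_topology = closed_base_topology (t_clans A) (g_map A ` elems A),
       space_points = s_clans A,
       time_points = clusters A,
       point_before = (\<lambda>\<Gamma> \<Delta>. \<forall>a\<in>\<Gamma>. \<forall>b\<in>\<Delta>. precedence A a b),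
       closed_base = g_map A ` elems A \<rparr>"

definition RC :: "'p dynamic_space \<Rightarrow> 'p set dca" where
  "RC S = (let X = space_topology S in
     \<lparr> elems = {a. a \<subseteq> topspace X \<and> X closure_of (X interior_of a) = a},
       join = (\<lambda>a b. a \<union> b),
       meet = (\<lambda>a b. X closure_of (X interior_of (a \<inter> b))),
       compl = (\<lambda>a. X closure_of (topspace X - a)),
       zero = {},
       one = topspace X,
       space_contact = (\<lambda>a b. a \<inter> b \<inter> space_points S \<noteq> {}),
       time_contact = (\<lambda>a b. a \<inter> b \<noteq> {}),
       precedence = (\<lambda>a b. \<exists>x\<in>a. \<exists>y\<in>b. point_before S x y) \<rparr>)"

definition dual_algebra :: "'p dynamic_space \<Rightarrow> 'p set dca" where
  "dual_algebra S = restrict_dca (RC S) (closed_base S)"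

text \<open>
  For a dynamic contact algebra the sets \<open>g_map A a\<close> do form a closed base of a topology
  with underlying set \<open>t_clans A\<close>, so the use of \<^const>\<open>topology\<close> above is legitimate.
\<close>

context dynamic_contact_algebra
begin

lemma below_join:
  assumes "a \<in> elems A" "b \<in> elems A"
  shows "below A a (a \<oplus> b)" "below A b (a \<oplus> b)"
proof -
  have idem: "c \<oplus> c = c" if "c \<in> elems A" for c
    using join_absorb[of c "c \<oplus> c"] meet_absorb[of c c] join_closed[of c c] that by simp
  have *: "below A a (a \<oplus> b)" if "a \<in> elems A" "b \<in> elems A" for a b
    using join_assoc[of a a b] idem[of a] that by (simp add: below_def)
  show "below A a (a \<oplus> b)" "below A b (a \<oplus> b)"
    using *[of a b] *[of b a] join_comm[of a b] assms by simp_all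
qed

lemma g_map_join:
  assumes "a \<in> elems A" "b \<in> elems A"
  shows "g_map A (a \<oplus> b) = g_map A a \<union> g_map A b"
  using assms below_join[OF assms] join_closed[OF assms]
  unfolding g_map_def t_clans_def clan_def by blast

lemma openin_canonical_space:
  "openin (space_topology (canonical_space A)) U \<longleftrightarrow>
     (\<exists>F \<subseteq> g_map A ` elems A. U = (\<Union>m\<in>F. t_clans A - m))"
proof -
  define P where "P = (\<lambda>U. \<exists>m\<in>g_map A ` elems A. U = t_clans A - m)"
  have "P (S \<inter> T)" if PS: "P S" and PT: "P T" for S T
  proof -
    obtain a b where ab: "a \<in> elems A" "b \<in> elems A"
      and S: "S = t_clans A - g_map A a" and T: "T = t_clans A - g_map A b"
      using PS PT unfolding P_def by blast
    then have "S \<inter> T = t_clans A - g_map A (a \<oplus> b)"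
      by (auto simp: g_map_join)
    then show ?thesis
      using join_closed[OF ab] unfolding P_def by blast
  qed
  then have "istopology (arbitrary union_of P)"
    by (rule istopology_base)
  then have "openin (space_topology (canonical_space A)) U \<longleftrightarrow> (arbitrary union_of P) U"
    by (simp add: canonical_space_def closed_base_topology_def topology_inverse' P_def)
  also have "\<dots> \<longleftrightarrow> (\<exists>F \<subseteq> g_map A ` elems A. U = (\<Union>m\<in>F. t_clans A - m))"
  proof
    assume "(arbitrary union_of P) U"
    then obtain \<U> where \<U>: "\<U> \<subseteq> Collect P" "U = \<Union>\<U>"
      by (auto simp: union_of_def arbitrary_def)
    then have "U = (\<Union>m\<in>{m \<in> g_map A ` elems A. t_clans A - m \<in> \<U>}. t_clans A - m)"
      unfolding P_def by blast
    then show "\<exists>F \<subseteq> g_map A ` elems A. U = (\<Union>m\<in>F. t_clans A - m)"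
      by (metis (no_types, lifting) mem_Collect_eq subsetI)
  next
    assume "\<exists>F \<subseteq> g_map A ` elems A. U = (\<Union>m\<in>F. t_clans A - m)"
    then obtain F where F: "F \<subseteq> g_map A ` elems A" "U = (\<Union>m\<in>F. t_clans A - m)"
      by blast
    then have "(\<lambda>m. t_clans A - m) ` F \<subseteq> Collect P"
      unfolding P_def by blast
    then show "(arbitrary union_of P) U"
      using F(2) by (auto simp: union_of_def arbitrary_def)
  qed
  finally show ?thesis .
qed

lemma topspace_canonical_space: "topspace (space_topology (canonical_space A)) = t_clans A"
proof -
  have "g_map A \<zero> = {}"
    by (auto simp: g_map_def t_clans_def clan_def)
  then have "openin (space_topology (canonical_space A)) (t_clans A)"
    unfolding openin_canonical_space using zero_closed
    by (intro exI[of _ "{{}}"]) auto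
  moreover have "U \<subseteq> t_clans A" if "openin (space_topology (canonical_space A)) U" for U
    using that unfolding openin_canonical_space by blast
  ultimately show ?thesis
    by (meson openin_subset openin_topspace subset_antisym)
qed

end

end

theory Submission
  imports Defs
begin

text \<open>
  A regular closed set \<open>a\<close> of the canonical space is determined by the filter
  \<open>F a = {x. a \<subseteq> g_map A x}\<close>: since the sets \<open>g_map A x\<close> form a closed base, a clan lies in
  \<open>a\<close> iff it includes \<open>F a\<close>. It is regularity of \<open>a\<close> that makes \<open>F a\<close> closed under meets,
  because \<open>g_map A (x \<odot> y)\<close> is only the regular part of \<open>g_map A x \<inter> g_map A y\<close>.

  If all members of two filters are related by a precontact, the filters extend to prime
  filters with the same property, and for a contact the union of these prime filters is a clan.
  Hence \<open>a\<close> and \<open>b\<close> are related in the algebra of regular closed sets iff all members of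
  \<open>F a\<close> are related to all members of \<open>F b\<close>. This is stability. Stability in turn transfers
  the interpolation conditions and the time axioms, with no further reference to the topology.
\<close>

section \<open>Boolean algebras with a carrier\<close>

context nontrivial_boolean_algebra
begin

lemmas carrier_closed [simp] = join_closed meet_closed compl_closed zero_closed one_closed

lemma join_idem: "a \<in> elems A \<Longrightarrow> a \<oplus> a = a"
  using join_absorb[of a "a \<oplus> a"] meet_absorb[of a a] by simp

lemma below_refl [simp]: "a \<in> elems A \<Longrightarrow> below A a a"
  by (simp add: below_def join_idem)

lemma below_trans:
  assumes "a \<in> elems A" "b \<in> elems A" "c \<in> elems A" "below A a b" "below A b c"
  shows "below A a c"
  using assms join_assoc[of a b c] by (simp add: below_def)

lemma below_antisym:
  "\<lbrakk>a \<in> elems A; b \<in> elems A; below A a b; below A b a\<rbrakk> \<Longrightarrow> a = b"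
  using join_comm[of a b] by (simp add: below_def)

lemma below_iff_meet:
  assumes "a \<in> elems A" "b \<in> elems A"
  shows "below A a b \<longleftrightarrow> a \<odot> b = a"
  using assms meet_absorb[of a b] join_absorb[of b a] meet_comm[of a b] join_comm[of a b]
  by (auto simp: below_def)

lemma below_join1: "\<lbrakk>a \<in> elems A; b \<in> elems A\<rbrakk> \<Longrightarrow> below A a (a \<oplus> b)"
  by (simp add: below_iff_meet meet_absorb)

lemma below_join2: "\<lbrakk>a \<in> elems A; b \<in> elems A\<rbrakk> \<Longrightarrow> below A b (a \<oplus> b)"
  using below_join1[of b a] join_comm[of a b] by simp

lemma join_least:
  "\<lbrakk>a \<in> elems A; b \<in> elems A; c \<in> elems A; below A a c; below A b c\<rbrakk> \<Longrightarrow> below A (a \<oplus> b) c"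
  by (simp add: below_def join_assoc)

lemma meet_below1: "\<lbrakk>a \<in> elems A; b \<in> elems A\<rbrakk> \<Longrightarrow> below A (a \<odot> b) a"
  using join_absorb[of a b] join_comm[of a "a \<odot> b"] by (simp add: below_def)

lemma meet_below2: "\<lbrakk>a \<in> elems A; b \<in> elems A\<rbrakk> \<Longrightarrow> below A (a \<odot> b) b"
  using meet_below1[of b a] meet_comm[of a b] by simp

lemma meet_greatest:
  "\<lbrakk>a \<in> elems A; b \<in> elems A; c \<in> elems A; below A c a; below A c b\<rbrakk> \<Longrightarrow> below A c (a \<odot> b)"
  using meet_assoc[of c a b] by (simp add: below_iff_meet)

lemma meet_mono:
  assumes "a \<in> elems A" "b \<in> elems A" "c \<in> elems A" "d \<in> elems A" "below A a c" "below A b d"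
  shows "below A (a \<odot> b) (c \<odot> d)"
  using assms below_trans[OF _ _ _ meet_below1[of a b], of c] below_trans[OF _ _ _ meet_below2[of a b], of d]
  by (intro meet_greatest) auto

lemma join_mono:
  assumes "a \<in> elems A" "b \<in> elems A" "c \<in> elems A" "d \<in> elems A" "below A a c" "below A b d"
  shows "below A (a \<oplus> b) (c \<oplus> d)"
  using assms below_trans[OF _ _ _ _ below_join1[of c d], of a]
    below_trans[OF _ _ _ _ below_join2[of c d], of b]
  by (intro join_least) auto

lemma below_one [simp]:
  assumes "a \<in> elems A" shows "below A a \<one>"
  using below_join1[of a "compl A a"] assms by (simp add: join_compl)

lemma zero_below [simp]:
  assumes "a \<in> elems A" shows "below A \<zero> a"
  using meet_below1[of a "compl A a"] assms by (simp add: meet_compl)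

lemma below_zero: "\<lbrakk>a \<in> elems A; below A a \<zero>\<rbrakk> \<Longrightarrow> a = \<zero>"
  by (simp add: below_antisym)

text \<open>Splitting \<open>a\<close> along \<open>b \<oplus> compl A b\<close> leaves only the
  part under \<open>compl A b\<close>. The double complement and De Morgan laws below rest on this
  description of the complement and on its dual.\<close>

lemma below_compl_iff:
  assumes "a \<in> elems A" "b \<in> elems A"
  shows "below A a (compl A b) \<longleftrightarrow> a \<odot> b = \<zero>"
proof
  assume "below A a (compl A b)"
  then have "below A (a \<odot> b) (compl A b \<odot> b)"
    using assms by (intro meet_mono) auto
  moreover have "compl A b \<odot> b = \<zero>"
    using assms meet_comm[of b "compl A b"] by (simp add: meet_compl)
  ultimately show "a \<odot> b = \<zero>"
    using assms by (simp add: below_zero)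
next
  assume "a \<odot> b = \<zero>"
  then have "a \<odot> (b \<oplus> compl A b) = \<zero> \<oplus> (a \<odot> compl A b)"
    using assms by (simp add: meet_distrib)
  moreover have "a \<odot> (b \<oplus> compl A b) = a"
    using assms below_iff_meet[of a \<one>] by (simp add: join_compl)
  moreover have "\<zero> \<oplus> (a \<odot> compl A b) = a \<odot> compl A b"
    using assms zero_below[of "a \<odot> compl A b"] by (simp add: below_def)
  ultimately show "below A a (compl A b)"
    using assms by (simp add: below_iff_meet)
qed

text \<open>Dual to \<open>below_compl_iff\<close>, but proved from the same law: the axioms give
  distributivity of meet over join, so here \<open>compl A a\<close> is split along
  \<open>a \<oplus> b\<close>.\<close>

lemma compl_below_iff:
  assumes "a \<in> elems A" "b \<in> elems A"
  shows "below A (compl A a) b \<longleftrightarrow> a \<oplus> b = \<one>"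
proof
  assume "below A (compl A a) b"
  then have "below A (a \<oplus> compl A a) (a \<oplus> b)"
    using assms by (intro join_mono) auto
  then show "a \<oplus> b = \<one>"
    using assms by (intro below_antisym) (auto simp: join_compl)
next
  let ?a = "compl A a"
  assume "a \<oplus> b = \<one>"
  then have "?a \<odot> (a \<oplus> b) = ?a"
    using assms below_iff_meet[of ?a \<one>] by simp
  moreover have "?a \<odot> (a \<oplus> b) = \<zero> \<oplus> (?a \<odot> b)"
    using assms meet_comm[of ?a a] by (simp add: meet_distrib meet_compl)
  moreover have "\<zero> \<oplus> (?a \<odot> b) = ?a \<odot> b"
    using assms zero_below[of "?a \<odot> b"] by (simp add: below_def)
  ultimately show "below A ?a b"
    using assms by (simp add: below_iff_meet)
qed

lemma compl_compl [simp]: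
  assumes "a \<in> elems A"
  shows "compl A (compl A a) = a"
  using assms join_comm[of a "compl A a"]
  by (intro below_antisym) (auto simp: below_compl_iff compl_below_iff meet_compl join_compl)

lemma below_iff_meet_compl:
  "\<lbrakk>a \<in> elems A; b \<in> elems A\<rbrakk> \<Longrightarrow> below A a b \<longleftrightarrow> a \<odot> compl A b = \<zero>"
  using below_compl_iff[of a "compl A b"] by simp

lemma compl_antimono:
  assumes "a \<in> elems A" "b \<in> elems A" "below A a b"
  shows "below A (compl A b) (compl A a)"
  using assms join_mono[of a "compl A a" b "compl A a"]
  by (auto simp: compl_below_iff join_compl intro: below_antisym)

text \<open>De Morgan in the direction that \<open>g_map_meet\<close> uses, where a meet is computed
  from complements.\<close>

lemma compl_join_compl:
  assumes "a \<in> elems A" "b \<in> elems A"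
  shows "compl A (compl A a \<oplus> compl A b) = a \<odot> b"
proof (rule below_antisym)
  let ?c = "compl A a \<oplus> compl A b"
  have "below A (compl A ?c) a" "below A (compl A ?c) b"
    using assms compl_antimono[of "compl A a" ?c] compl_antimono[of "compl A b" ?c]
    by (auto simp: below_join1 below_join2)
  then show "below A (compl A ?c) (a \<odot> b)"
    using assms by (intro meet_greatest) auto
  have "(a \<odot> b) \<odot> compl A a = \<zero>" "(a \<odot> b) \<odot> compl A b = \<zero>"
    using assms by (simp_all flip: below_iff_meet_compl add: meet_below1 meet_below2)
  then show "below A (a \<odot> b) (compl A ?c)"
    using assms by (simp add: below_compl_iff meet_distrib join_idem)
qed (use assms in auto)

end

section \<open>Prime filters and precontact relations\<close>

context nontrivial_boolean_algebra
begin

definition lattice_filter :: "'a set \<Rightarrow> bool" where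
  "lattice_filter F \<longleftrightarrow> F \<subseteq> elems A \<and> \<one> \<in> F \<and> (\<forall>a\<in>F. \<forall>b\<in>elems A. below A a b \<longrightarrow> b \<in> F) \<and>
     (\<forall>a\<in>F. \<forall>b\<in>F. a \<odot> b \<in> F)"

definition lattice_ideal :: "'a set \<Rightarrow> bool" where
  "lattice_ideal I \<longleftrightarrow> I \<subseteq> elems A \<and> \<zero> \<in> I \<and> (\<forall>a\<in>I. \<forall>b\<in>elems A. below A b a \<longrightarrow> b \<in> I) \<and>
     (\<forall>a\<in>I. \<forall>b\<in>I. a \<oplus> b \<in> I)"

definition prime_filter :: "'a set \<Rightarrow> bool" where
  "prime_filter U \<longleftrightarrow> lattice_filter U \<and> \<zero> \<notin> U \<and>
     (\<forall>a\<in>elems A. \<forall>b\<in>elems A. a \<oplus> b \<in> U \<longrightarrow> a \<in> U \<or> b \<in> U)"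

lemma filter_upset:
  assumes "a \<in> elems A"
  shows "lattice_filter {x \<in> elems A. below A a x}"
  using assms by (auto simp: lattice_filter_def intro: meet_greatest below_trans)

lemma ideal_downset:
  assumes "a \<in> elems A"
  shows "lattice_ideal {x \<in> elems A. below A x a}"
  using assms by (auto simp: lattice_ideal_def intro: join_least below_trans)

text \<open>This is the filter generated by \<open>M\<close> and \<open>a\<close>, the competitor
  against which a maximal \<open>M\<close> is tested in the prime filter theorem.\<close>

lemma filter_adjoin:
  assumes "lattice_filter M" "a \<in> elems A"
  shows "lattice_filter {x \<in> elems A. \<exists>m\<in>M. below A (m \<odot> a) x}" (is "lattice_filter ?F")
proof -
  have M: "m \<in> elems A" if "m \<in> M" for m
    using assms that by (auto simp: lattice_filter_def)
  have "x \<odot> y \<in> ?F" if xy: "x \<in> ?F" "y \<in> ?F" for x y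
  proof -
    obtain m n where *: "m \<in> M" "n \<in> M" "below A (m \<odot> a) x" "below A (n \<odot> a) y"
      "x \<in> elems A" "y \<in> elems A"
      using xy by blast
    have "below A ((m \<odot> n) \<odot> a) (m \<odot> a)" "below A ((m \<odot> n) \<odot> a) (n \<odot> a)"
      using * M assms by (auto intro!: meet_mono meet_below1 meet_below2)
    then have "below A ((m \<odot> n) \<odot> a) (x \<odot> y)"
      using * M assms below_trans[of "(m \<odot> n) \<odot> a" "m \<odot> a" x]
        below_trans[of "(m \<odot> n) \<odot> a" "n \<odot> a" y]
      by (auto intro: meet_greatest)
    moreover have "m \<odot> n \<in> M"
      using * assms by (auto simp: lattice_filter_def)
    ultimately show ?thesis
      using * by auto
  qed
  moreover have "\<one> \<in> ?F"
  proof -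
    have "\<one> \<in> M"
      using assms by (simp add: lattice_filter_def)
    moreover have "below A (\<one> \<odot> a) \<one>"
      using assms by simp
    ultimately show ?thesis
      by auto
  qed
  moreover have "y \<in> ?F" if "x \<in> ?F" "y \<in> elems A" "below A x y" for x y
  proof -
    obtain m where "m \<in> M" "below A (m \<odot> a) x" "x \<in> elems A"
      using \<open>x \<in> ?F\<close> by blast
    then have "below A (m \<odot> a) y"
      using M assms that below_trans[of "m \<odot> a" x y] by simp
    then show ?thesis
      using \<open>m \<in> M\<close> that by blast
  qed
  ultimately show ?thesis
    unfolding lattice_filter_def by blast
qed

text \<open>Zorn's lemma gives a filter \<open>M\<close> that is maximal among those including
  \<open>F\<close> and avoiding \<open>I\<close>. Maximality makes it prime: two elements outside
  \<open>M\<close> whose join is inside would, by distributivity, force \<open>M\<close> to meet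
  \<open>I\<close>.\<close>

theorem prime_filter_extension:
  assumes F: "lattice_filter F" and I: "lattice_ideal I" and disj: "F \<inter> I = {}"
  obtains U where "prime_filter U" "F \<subseteq> U" "U \<inter> I = {}"
proof -
  define \<F> where "\<F> = {K. lattice_filter K \<and> F \<subseteq> K \<and> K \<inter> I = {}}"
  have "\<Union>\<C> \<in> \<F>" if "\<C> \<noteq> {}" and chain: "subset.chain \<F> \<C>" for \<C>
  proof -
    have sub: "\<C> \<subseteq> \<F>" and lin: "\<And>K L. K \<in> \<C> \<Longrightarrow> L \<in> \<C> \<Longrightarrow> K \<subseteq> L \<or> L \<subseteq> K"
      using chain by (auto simp: subset.chain_def)
    have "a \<odot> b \<in> \<Union>\<C>" if ab: "a \<in> \<Union>\<C>" "b \<in> \<Union>\<C>" for a b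
    proof -
      obtain K where "K \<in> \<C>" "a \<in> K" "b \<in> K"
        using ab lin by blast
      moreover from this have "a \<odot> b \<in> K"
        using sub by (auto simp: \<F>_def lattice_filter_def)
      ultimately show ?thesis
        by blast
    qed
    moreover have "\<Union>\<C> \<subseteq> elems A" "\<one> \<in> \<Union>\<C>"
      using sub \<open>\<C> \<noteq> {}\<close> by (auto simp: \<F>_def lattice_filter_def)
    moreover have "b \<in> \<Union>\<C>" if "a \<in> \<Union>\<C>" "b \<in> elems A" "below A a b" for a b
    proof -
      obtain K where "K \<in> \<C>" "a \<in> K"
        using \<open>a \<in> \<Union>\<C>\<close> by blast
      moreover from this have "b \<in> K"
        using sub that by (auto simp: \<F>_def lattice_filter_def)
      ultimately show ?thesis
        by blast
    qed
    ultimately have "lattice_filter (\<Union>\<C>)"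
      unfolding lattice_filter_def by blast
    then show ?thesis
      using sub \<open>\<C> \<noteq> {}\<close> unfolding \<F>_def by blast
  qed
  moreover have "\<F> \<noteq> {}"
    using F disj by (auto simp: \<F>_def)
  ultimately obtain M where M: "M \<in> \<F>" and max: "\<And>K. K \<in> \<F> \<Longrightarrow> M \<subseteq> K \<Longrightarrow> K = M"
    using subset_Zorn_nonempty[of \<F>] by blast
  have fM: "lattice_filter M" "F \<subseteq> M" "M \<inter> I = {}" and Me: "\<And>m. m \<in> M \<Longrightarrow> m \<in> elems A"
    using M by (auto simp: \<F>_def lattice_filter_def)
  \<comment> \<open>Adjoining \<open>a\<close> to \<open>M\<close> gives a strictly larger filter.
    By maximality it meets \<open>I\<close>, and since \<open>I\<close> is a down-set it then
    contains a generator \<open>m \<odot> a\<close>.\<close>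
  have meets_ideal: "\<exists>m\<in>M. m \<odot> a \<in> I" if a: "a \<in> elems A" "a \<notin> M" for a
  proof -
    let ?K = "{x \<in> elems A. \<exists>m\<in>M. below A (m \<odot> a) x}"
    have "M \<subseteq> ?K"
      using Me a by (auto intro!: bexI meet_below1)
    moreover have "a \<in> ?K"
      using a fM(1) by (auto simp: lattice_filter_def intro!: bexI[of _ \<one>] meet_below2)
    ultimately have "?K \<notin> \<F>"
      using max a by blast
    then have "?K \<inter> I \<noteq> {}"
      using filter_adjoin[OF fM(1) a(1)] \<open>M \<subseteq> ?K\<close> fM(2) by (auto simp: \<F>_def)
    then obtain x m where xm: "x \<in> I" "m \<in> M" "below A (m \<odot> a) x"
      by blast
    then have "m \<odot> a \<in> I"
      using I Me a unfolding lattice_ideal_def by (meson meet_closed)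
    then show ?thesis
      using xm by blast
  qed
  have "a \<in> M \<or> b \<in> M" if ab: "a \<in> elems A" "b \<in> elems A" "a \<oplus> b \<in> M" for a b
  proof (rule ccontr)
    assume "\<not> (a \<in> M \<or> b \<in> M)"
    then obtain m n where mn: "m \<in> M" "n \<in> M" "m \<odot> a \<in> I" "n \<odot> b \<in> I"
      using meets_ideal ab by metis
    \<comment> \<open>The common multiplier puts both products in \<open>I\<close> at once, so
      \<open>?k \<odot> (a \<oplus> b)\<close> lies in \<open>I\<close> by distributivity and in
      \<open>M\<close> by filter closure.\<close>
    let ?k = "m \<odot> n"
    have "below A (?k \<odot> a) (m \<odot> a)" "below A (?k \<odot> b) (n \<odot> b)"
      using mn Me ab by (auto intro!: meet_mono meet_below1 meet_below2)
    then have "?k \<odot> a \<in> I" "?k \<odot> b \<in> I"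
      using I mn Me ab by (auto simp: lattice_ideal_def)
    then have "?k \<odot> (a \<oplus> b) \<in> I"
      using I Me mn ab by (simp add: meet_distrib lattice_ideal_def)
    moreover have "?k \<odot> (a \<oplus> b) \<in> M"
      using fM(1) mn ab by (auto simp: lattice_filter_def)
    ultimately show False
      using fM(3) by blast
  qed
  moreover have "\<zero> \<notin> M"
    using I fM(3) by (auto simp: lattice_ideal_def)
  ultimately have "prime_filter M"
    using fM(1) unfolding prime_filter_def by blast
  then show thesis
    using that fM by blast
qed

text \<open>The principal filter of \<open>a\<close> is disjoint from the principal ideal of
  \<open>b\<close>. This supplies enough points to reflect the order in
  \<open>g_map_subset_iff\<close>.\<close>

lemma prime_filter_separation:
  assumes "a \<in> elems A" "b \<in> elems A" "\<not> below A a b"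
  obtains U where "prime_filter U" "a \<in> U" "b \<notin> U"
proof -
  have "{x \<in> elems A. below A a x} \<inter> {x \<in> elems A. below A x b} = {}"
    using assms below_trans by blast
  then show thesis
    using prime_filter_extension[OF filter_upset[OF assms(1)] ideal_downset[OF assms(2)]]
      assms that by (smt (verit) below_refl disjoint_iff mem_Collect_eq subset_iff)
qed

section \<open>Related prime filters and the clans built from them\<close>

lemma ideal_unrelated_left:
  assumes C: "precontact_relation A C" and G: "lattice_filter G"
  shows "lattice_ideal {a \<in> elems A. \<exists>y\<in>G. \<not> C a y}" (is "lattice_ideal ?I")
proof -
  interpret precontact_relation A C by fact
  have Ge: "y \<in> elems A" if "y \<in> G" for y
    using G that by (auto simp: lattice_filter_def)
  have "a \<oplus> b \<in> ?I" if ab: "a \<in> ?I" "b \<in> ?I" for a b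
  proof -
    obtain x y where xy: "x \<in> G" "y \<in> G" "\<not> C a x" "\<not> C b y" "a \<in> elems A" "b \<in> elems A"
      using ab by auto
    \<comment> \<open>The two witnesses merge into their meet: it is below both, so it is unrelated
      to \<open>a\<close> and to \<open>b\<close>, hence to the join.\<close>
    have "\<not> C (a \<oplus> b) (x \<odot> y)"
      using xy Ge join_left[of a b "x \<odot> y"] upward_monotone[of a "x \<odot> y" a x]
        upward_monotone[of b "x \<odot> y" b y] by (auto simp: meet_below1 meet_below2)
    moreover have "x \<odot> y \<in> G"
      using G xy by (auto simp: lattice_filter_def)
    ultimately show ?thesis
      using xy by auto
  qed
  moreover have "b \<in> ?I" if ab: "a \<in> ?I" "b \<in> elems A" "below A b a" for a b
  proof -
    obtain y where "y \<in> G" "\<not> C a y"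
      using ab by blast
    then have "\<not> C b y"
      using ab Ge upward_monotone[of b y a y] by auto
    then show ?thesis
      using ab \<open>y \<in> G\<close> by blast
  qed
  moreover have "\<zero> \<in> ?I"
    using nonzero[of \<zero> \<one>] G by (auto simp: lattice_filter_def)
  ultimately show ?thesis
    unfolding lattice_ideal_def by blast
qed

text \<open>Makes \<open>ideal_unrelated_left\<close> available for the second argument of a
  relation.\<close>

lemma precontact_converse:
  assumes "precontact_relation A C"
  shows "precontact_relation A (\<lambda>a b. C b a)"
proof -
  interpret precontact_relation A C by fact
  show ?thesis
    by unfold_locales (use nonzero upward_monotone join_left join_right in blast)+
qed

text \<open>Being related to all of \<open>G\<close> means avoiding the ideal of
  \<open>ideal_unrelated_left\<close>, so the prime filter theorem applies. The extensions are made
  in turn: \<open>F\<close> grows to \<open>U\<close> against \<open>G\<close>, and then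
  \<open>G\<close> grows to \<open>V\<close> against the \<open>U\<close> already chosen.\<close>

theorem prime_filter_pair_extension:
  assumes C: "precontact_relation A C" and F: "lattice_filter F" and G: "lattice_filter G"
    and rel: "\<And>x y. x \<in> F \<Longrightarrow> y \<in> G \<Longrightarrow> C x y"
  obtains U V where "prime_filter U" "prime_filter V" "F \<subseteq> U" "G \<subseteq> V"
    "\<And>x y. x \<in> U \<Longrightarrow> y \<in> V \<Longrightarrow> C x y"
proof -
  have "F \<inter> {a \<in> elems A. \<exists>y\<in>G. \<not> C a y} = {}"
    using rel by blast
  then obtain U where U: "prime_filter U" "F \<subseteq> U" "U \<inter> {a \<in> elems A. \<exists>y\<in>G. \<not> C a y} = {}"
    by (rule prime_filter_extension[OF F ideal_unrelated_left[OF C G]])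
  then have fU: "lattice_filter U" "U \<subseteq> elems A"
    by (auto simp: prime_filter_def lattice_filter_def)
  have "G \<inter> {b \<in> elems A. \<exists>x\<in>U. \<not> C x b} = {}"
    using U(3) fU by blast
  then obtain V where V: "prime_filter V" "G \<subseteq> V" "V \<inter> {b \<in> elems A. \<exists>x\<in>U. \<not> C x b} = {}"
    by (rule prime_filter_extension[OF G ideal_unrelated_left[OF precontact_converse[OF C] fU(1)]])
  moreover have "V \<subseteq> elems A"
    using V by (auto simp: prime_filter_def lattice_filter_def)
  ultimately have "C x y" if "x \<in> U" "y \<in> V" for x y
    using that by blast
  then show thesis
    using that U V by blast
qed

text \<open>Two members of one prime filter have a nonzero meet and are in contact by
  \<open>overlap\<close>; members of different ones are in contact by \<open>rel\<close>. Upward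
  closure and primeness survive unions, although closure under meets may be lost.\<close>

lemma clan_union_prime_filters:
  assumes C: "contact_relation A C" and U: "prime_filter U" and V: "prime_filter V"
    and rel: "\<And>x y. x \<in> U \<Longrightarrow> y \<in> V \<Longrightarrow> C x y"
  shows "clan A C (U \<union> V)"
proof -
  interpret contact_relation A C by fact
  have in_elems: "U \<subseteq> elems A" "V \<subseteq> elems A"
    using U V by (auto simp: prime_filter_def lattice_filter_def)
  have within: "C x y" if W: "prime_filter W" "x \<in> W" "y \<in> W" for W x y
  proof -
    have "x \<odot> y \<in> W" "\<zero> \<notin> W" "x \<in> elems A" "y \<in> elems A"
      using W unfolding prime_filter_def lattice_filter_def by blast+
    then show ?thesis
      using overlap[of x y] by metis
  qed
  have "C x y" if "x \<in> U \<union> V" "y \<in> U \<union> V" for x y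
    using that within[OF U] within[OF V] rel symmetric in_elems by blast
  then show ?thesis
    using U V unfolding clan_def prime_filter_def lattice_filter_def by blast
qed

lemma clan_prime_filter:
  assumes C: "contact_relation A C" and U: "prime_filter U"
  shows "clan A C U"
proof -
  interpret contact_relation A C by fact
  have "C x y" if "x \<in> U" "y \<in> U" for x y
  proof -
    have "x \<odot> y \<in> U" "\<zero> \<notin> U" "x \<in> elems A" "y \<in> elems A"
      using that U unfolding prime_filter_def lattice_filter_def by blast+
    then show ?thesis
      using overlap[of x y] by metis
  qed
  then show ?thesis
    using clan_union_prime_filters[OF C U U] by simp
qed

end

section \<open>Regular closed sets\<close>

lemma RC_simps [simp]:
  "a \<in> elems (RC S) \<longleftrightarrow>
     a \<subseteq> topspace (space_topology S) \<and> space_topology S closure_of (space_topology S interior_of a) = a"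
  "join (RC S) a b = a \<union> b"
  "meet (RC S) a b = space_topology S closure_of (space_topology S interior_of (a \<inter> b))"
  "compl (RC S) a = space_topology S closure_of (topspace (space_topology S) - a)"
  "zero (RC S) = {}"
  "one (RC S) = topspace (space_topology S)"
  "space_contact (RC S) a b \<longleftrightarrow> a \<inter> b \<inter> space_points S \<noteq> {}"
  "time_contact (RC S) a b \<longleftrightarrow> a \<inter> b \<noteq> {}"
  "precedence (RC S) a b \<longleftrightarrow> (\<exists>x\<in>a. \<exists>y\<in>b. point_before S x y)"
  by (simp_all add: RC_def Let_def)

lemma below_RC [simp]: "below (RC S) a b \<longleftrightarrow> a \<subseteq> b"
  by (auto simp: below_def)

lemma RC_closedin: "a \<in> elems (RC S) \<Longrightarrow> closedin (space_topology S) a"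
  by (metis RC_simps(1) closedin_closure_of)

text \<open>The source of closure under meet and complement, both of which are closures of open
  sets. An open \<open>U\<close> lies in the interior of its closure, which gives the nontrivial
  inclusion.\<close>

lemma closure_of_openin_RC:
  assumes "openin (space_topology S) U"
  shows "space_topology S closure_of U \<in> elems (RC S)"
proof -
  let ?X = "space_topology S"
  have "?X closure_of U \<subseteq> ?X closure_of (?X interior_of (?X closure_of U))"
    using assms by (intro closure_of_mono interior_of_maximal closure_of_subset) (auto dest: openin_subset)
  moreover have "?X closure_of (?X interior_of (?X closure_of U)) \<subseteq> ?X closure_of U"
    by (intro closure_of_minimal interior_of_subset) auto
  ultimately show ?thesis
    by (simp add: closure_of_subset_topspace)
qed

text \<open>A regular closed \<open>d\<close> inside \<open>a \<inter> b\<close> is the closure of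
  its own interior, hence inside the closure of the interior of \<open>a \<inter> b\<close>. This
  lets meets be handled by order arguments instead of topology.\<close>

lemma RC_meet_greatest:
  assumes "d \<in> elems (RC S)" "a \<in> elems (RC S)" "b \<in> elems (RC S)"
  shows "d \<subseteq> meet (RC S) a b \<longleftrightarrow> d \<subseteq> a \<and> d \<subseteq> b"
proof
  let ?X = "space_topology S"
  have "?X closure_of (?X interior_of (a \<inter> b)) \<subseteq> ?X closure_of (?X interior_of a)"
    "?X closure_of (?X interior_of (a \<inter> b)) \<subseteq> ?X closure_of (?X interior_of b)"
    by (intro closure_of_mono interior_of_mono; simp)+
  then show "d \<subseteq> a \<and> d \<subseteq> b" if "d \<subseteq> meet (RC S) a b"
    using that assms by auto
  show "d \<subseteq> meet (RC S) a b" if "d \<subseteq> a \<and> d \<subseteq> b"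
  proof -
    have "?X closure_of (?X interior_of d) \<subseteq> ?X closure_of (?X interior_of (a \<inter> b))"
      using that by (intro closure_of_mono interior_of_mono) auto
    then show ?thesis
      using assms by simp
  qed
qed

lemma RC_meet_closed:
  "meet (RC S) a b \<in> elems (RC S)"
  unfolding RC_simps(3) by (rule closure_of_openin_RC) simp

lemma RC_compl_closed:
  "a \<in> elems (RC S) \<Longrightarrow> compl (RC S) a \<in> elems (RC S)"
  unfolding RC_simps(4)
  by (rule closure_of_openin_RC) (use RC_closedin[of a S] in \<open>simp add: closedin_def del: RC_simps\<close>)

lemma RC_join_closed:
  assumes "a \<in> elems (RC S)" "b \<in> elems (RC S)"
  shows "join (RC S) a b \<in> elems (RC S)"
proof -
  let ?X = "space_topology S"
  have "?X closure_of (?X interior_of (a \<union> b)) \<subseteq> a \<union> b"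
    using assms[THEN RC_closedin] by (intro closure_of_minimal interior_of_subset) auto
  moreover have "?X closure_of (?X interior_of a) \<subseteq> ?X closure_of (?X interior_of (a \<union> b))"
    "?X closure_of (?X interior_of b) \<subseteq> ?X closure_of (?X interior_of (a \<union> b))"
    by (intro closure_of_mono interior_of_mono; simp)+
  ultimately show ?thesis
    using assms by auto
qed

text \<open>Because \<open>?O\<close> is open, each point of \<open>?O\<close> in the closure of the
  interior of \<open>d\<close> is a limit of points of \<open>?O\<close> in that interior. Applied
  with \<open>d\<close> as \<open>b\<close> and as \<open>c\<close>, this covers all of
  \<open>?O\<close>.\<close>

lemma RC_meet_distrib:
  assumes "a \<in> elems (RC S)" "b \<in> elems (RC S)" "c \<in> elems (RC S)"
  shows "meet (RC S) a (b \<union> c) = meet (RC S) a b \<union> meet (RC S) a c"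
proof
  let ?X = "space_topology S"
  let ?O = "?X interior_of (a \<inter> (b \<union> c))"
  have part: "?O \<inter> d \<subseteq> meet (RC S) a d" if "d \<in> elems (RC S)" for d
  proof -
    have "?O \<inter> ?X closure_of (?X interior_of d) \<subseteq> ?X closure_of (?O \<inter> ?X interior_of d)"
      by (rule openin_Int_closure_of_subset) simp
    also have "\<dots> \<subseteq> ?X closure_of (?X interior_of (a \<inter> d))"
    proof (intro closure_of_mono interior_of_maximal)
      show "?O \<inter> ?X interior_of d \<subseteq> a \<inter> d"
        using interior_of_subset[of ?X "a \<inter> (b \<union> c)"] interior_of_subset[of ?X d] by blast
    qed auto
    finally show ?thesis
      using that by simp
  qed
  have "?O \<subseteq> b \<union> c"
    using interior_of_subset[of ?X "a \<inter> (b \<union> c)"] by blast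
  then have "?O \<subseteq> meet (RC S) a b \<union> meet (RC S) a c"
    using part[OF assms(2)] part[OF assms(3)] by blast
  then show "meet (RC S) a (b \<union> c) \<subseteq> meet (RC S) a b \<union> meet (RC S) a c"
    unfolding RC_simps(3)[of S a "b \<union> c"] by (intro closure_of_minimal) auto
  show "meet (RC S) a b \<union> meet (RC S) a c \<subseteq> meet (RC S) a (b \<union> c)"
    unfolding RC_simps(3) by (intro Un_least closure_of_mono interior_of_mono) auto
qed

text \<open>Point witnesses distribute over unions, which are the joins here. \<open>R\<close> will
  be equality for time contact, equality on s-clans for space contact and
  \<open>point_before\<close> for precedence.\<close>

lemma RC_precontact:
  assumes D: "\<And>a b. D a b \<longleftrightarrow> (\<exists>x\<in>a. \<exists>y\<in>b. R x y)"
  shows "precontact_relation (RC S) D"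
proof
  show "D a' b'" if "D a b" "below (RC S) a a'" "below (RC S) b b'" for a b a' b'
    using that(1) subsetD[OF that(2)[unfolded below_RC]] subsetD[OF that(3)[unfolded below_RC]]
    unfolding D by metis
  show "D a b \<or> D a c" if "D a (join (RC S) b c)" for a b c
    using that unfolding D RC_simps(2) bex_Un by metis
  show "D a c \<or> D b c" if "D (join (RC S) a b) c" for a b c
    using that unfolding D RC_simps(2) bex_Un by metis
  show "a \<noteq> zero (RC S) \<and> b \<noteq> zero (RC S)" if "D a b" for a b
    using that unfolding D RC_simps(5) by (metis empty_iff)
qed

theorem RC_boolean_algebra:
  assumes "topspace (space_topology S) \<noteq> {}"
  shows "nontrivial_boolean_algebra (RC S)"
proof
  let ?X = "space_topology S"
  fix a b c
  assume a: "a \<in> elems (RC S)"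
  have compl_eq: "compl (RC S) a = topspace ?X - ?X interior_of a"
    by (simp add: closure_of_complement)
  show "join (RC S) a (compl (RC S) a) = one (RC S)"
    unfolding compl_eq using a interior_of_subset[of ?X a] by (auto simp del: RC_simps(4))
  \<comment> \<open>The interior of this intersection lies in the interior of \<open>a\<close> by
    monotonicity and outside it by construction.\<close>
  have "?X interior_of (a \<inter> (topspace ?X - ?X interior_of a)) \<subseteq> {}"
    using interior_of_mono[of "a \<inter> (topspace ?X - ?X interior_of a)" a ?X]
      interior_of_subset[of ?X "a \<inter> (topspace ?X - ?X interior_of a)"] by auto
  then show "meet (RC S) a (compl (RC S) a) = zero (RC S)"
    unfolding compl_eq by simp
  show "compl (RC S) a \<in> elems (RC S)"
    by (rule RC_compl_closed[OF a])
  assume b: "b \<in> elems (RC S)"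
  show "join (RC S) a b \<in> elems (RC S)" "meet (RC S) a b \<in> elems (RC S)"
    using RC_join_closed[OF a b] RC_meet_closed by blast+
  show "join (RC S) a b = join (RC S) b a" "meet (RC S) a b = meet (RC S) b a"
    by (auto simp: Int_commute)
  show "join (RC S) a (meet (RC S) a b) = a"
    using RC_meet_greatest[OF RC_meet_closed a b, of a b] by auto
  show "meet (RC S) a (join (RC S) a b) = a"
    using a by (simp add: Int_absorb2)
  assume c: "c \<in> elems (RC S)"
  show "join (RC S) (join (RC S) a b) c = join (RC S) a (join (RC S) b c)"
    by auto
  show "meet (RC S) a (join (RC S) b c) = join (RC S) (meet (RC S) a b) (meet (RC S) a c)"
    using RC_meet_distrib[OF a b c] by simp
  \<comment> \<open>Associativity follows by comparing which regular closed sets lie below the two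
    sides.\<close>
  have "d \<subseteq> meet (RC S) (meet (RC S) a b) c \<longleftrightarrow> d \<subseteq> meet (RC S) a (meet (RC S) b c)"
    if "d \<in> elems (RC S)" for d
    using that a b c by (auto simp: RC_meet_greatest RC_meet_closed simp del: RC_simps)
  then show "meet (RC S) (meet (RC S) a b) c = meet (RC S) a (meet (RC S) b c)"
    using RC_meet_closed by (metis subset_antisym subset_refl)
next
  show "zero (RC S) \<noteq> one (RC S)"
    using assms by (metis RC_simps(5,6))
qed simp_all

section \<open>Stable embeddings\<close>

text \<open>The part of a stable isomorphic embedding that concerns a single relation. Keeping the
  relations as parameters lets the interpolation lemmas mix time contact and precedence.\<close>

definition stable_relation ::
  "('a \<Rightarrow> 'b) \<Rightarrow> 'a dca \<Rightarrow> 'b dca \<Rightarrow> ('a \<Rightarrow> 'a \<Rightarrow> bool) \<Rightarrow> ('b \<Rightarrow> 'b \<Rightarrow> bool) \<Rightarrow> bool" where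
  "stable_relation h A\<^sub>1 A\<^sub>2 C\<^sub>1 C\<^sub>2 \<longleftrightarrow>
     (\<forall>a\<in>elems A\<^sub>1. \<forall>b\<in>elems A\<^sub>1. C\<^sub>1 a b \<longleftrightarrow> C\<^sub>2 (h a) (h b)) \<and>
     (\<forall>a\<in>elems A\<^sub>2. \<forall>b\<in>elems A\<^sub>2. \<not> C\<^sub>2 a b \<longrightarrow>
        (\<exists>x\<in>elems A\<^sub>1. \<exists>y\<in>elems A\<^sub>1. \<not> C\<^sub>1 x y \<and> below A\<^sub>2 a (h x) \<and> below A\<^sub>2 b (h y)))"

text \<open>Carries the Boolean data and density. The relations are supplied separately through
  \<open>stable_relation\<close>, so that the locale can be applied to \<open>RC\<close> before its
  interpolation axioms are established.\<close>

locale stable_embedding =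
  src: nontrivial_boolean_algebra A\<^sub>1 + tgt: nontrivial_boolean_algebra A\<^sub>2
  for A\<^sub>1 :: "'a dca" and A\<^sub>2 :: "'b dca" +
  fixes h :: "'a \<Rightarrow> 'b"
  assumes homomorphism: "boolean_homomorphism h A\<^sub>1 A\<^sub>2"
    and injective: "inj_on h (elems A\<^sub>1)"
    and dense: "\<lbrakk>a \<in> elems A\<^sub>2; a \<noteq> zero A\<^sub>2\<rbrakk> \<Longrightarrow> \<exists>x\<in>elems A\<^sub>1. x \<noteq> zero A\<^sub>1 \<and> below A\<^sub>2 (h x) a"
begin

lemma image_closed [simp]: "a \<in> elems A\<^sub>1 \<Longrightarrow> h a \<in> elems A\<^sub>2"
  using homomorphism by (auto simp: boolean_homomorphism_def)

lemma image_simps [simp]: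
  "h (zero A\<^sub>1) = zero A\<^sub>2"
  "h (one A\<^sub>1) = one A\<^sub>2"
  "a \<in> elems A\<^sub>1 \<Longrightarrow> h (compl A\<^sub>1 a) = compl A\<^sub>2 (h a)"
  "\<lbrakk>a \<in> elems A\<^sub>1; b \<in> elems A\<^sub>1\<rbrakk> \<Longrightarrow> h (join A\<^sub>1 a b) = join A\<^sub>2 (h a) (h b)"
  "\<lbrakk>a \<in> elems A\<^sub>1; b \<in> elems A\<^sub>1\<rbrakk> \<Longrightarrow> h (meet A\<^sub>1 a b) = meet A\<^sub>2 (h a) (h b)"
  using homomorphism by (auto simp: boolean_homomorphism_def)

lemma image_zero_iff [simp]: "a \<in> elems A\<^sub>1 \<Longrightarrow> h a = zero A\<^sub>2 \<longleftrightarrow> a = zero A\<^sub>1"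
  using inj_on_eq_iff[OF injective, of a "zero A\<^sub>1"] by simp

lemma image_below [simp]:
  "\<lbrakk>a \<in> elems A\<^sub>1; b \<in> elems A\<^sub>1\<rbrakk> \<Longrightarrow> below A\<^sub>2 (h a) (h b) \<longleftrightarrow> below A\<^sub>1 a b"
  using inj_on_eq_iff[OF injective, of "join A\<^sub>1 a b" b] by (simp add: below_def)

text \<open>Allows covers of \<open>p\<close> and of its complement to be chosen independently: the
  second may be shrunk to the complement of the first.\<close>

lemma complementary_cover:
  assumes "p \<in> elems A\<^sub>2" "x \<in> elems A\<^sub>1" "y \<in> elems A\<^sub>1"
    "below A\<^sub>2 p (h x)" "below A\<^sub>2 (compl A\<^sub>2 p) (h y)"
  shows "below A\<^sub>1 (compl A\<^sub>1 x) y"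
proof -
  have "below A\<^sub>2 (compl A\<^sub>2 (h x)) (compl A\<^sub>2 p)"
    using assms tgt.compl_antimono by simp
  then have "below A\<^sub>2 (h (compl A\<^sub>1 x)) (h y)"
    using assms tgt.below_trans[of "compl A\<^sub>2 (h x)" "compl A\<^sub>2 p" "h y"] by simp
  then show ?thesis
    using assms image_below[of "compl A\<^sub>1 x" y] by simp
qed

lemma stable_iff:
  "\<lbrakk>stable_relation h A\<^sub>1 A\<^sub>2 C\<^sub>1 C\<^sub>2; a \<in> elems A\<^sub>1; b \<in> elems A\<^sub>1\<rbrakk> \<Longrightarrow> C\<^sub>1 a b \<longleftrightarrow> C\<^sub>2 (h a) (h b)"
  by (auto simp: stable_relation_def)

lemma stable_cover:
  assumes "stable_relation h A\<^sub>1 A\<^sub>2 C\<^sub>1 C\<^sub>2" "a \<in> elems A\<^sub>2" "b \<in> elems A\<^sub>2" "\<not> C\<^sub>2 a b"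
  obtains x y where "x \<in> elems A\<^sub>1" "y \<in> elems A\<^sub>1" "\<not> C\<^sub>1 x y" "below A\<^sub>2 a (h x)" "below A\<^sub>2 b (h y)"
  using assms unfolding stable_relation_def by blast

section \<open>Transfer of interpolation and time axioms along a stable embedding\<close>

lemma precontact_pullback:
  assumes st: "stable_relation h A\<^sub>1 A\<^sub>2 C\<^sub>1 C\<^sub>2" and C: "precontact_relation A\<^sub>2 C\<^sub>2"
  shows "precontact_relation A\<^sub>1 C\<^sub>1"
proof -
  interpret precontact_relation A\<^sub>2 C\<^sub>2 by fact
  note iff = stable_iff[OF st]
  show ?thesis
  proof
    show "a \<noteq> zero A\<^sub>1 \<and> b \<noteq> zero A\<^sub>1" if "a \<in> elems A\<^sub>1" "b \<in> elems A\<^sub>1" "C\<^sub>1 a b" for a b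
      using that nonzero[of "h a" "h b"] iff by simp
    show "C\<^sub>1 a' b'" if "a \<in> elems A\<^sub>1" "b \<in> elems A\<^sub>1" "a' \<in> elems A\<^sub>1" "b' \<in> elems A\<^sub>1" "C\<^sub>1 a b"
      "below A\<^sub>1 a a'" "below A\<^sub>1 b b'" for a b a' b'
      using that upward_monotone[of "h a" "h b" "h a'" "h b'"] iff by simp
    show "C\<^sub>1 a b \<or> C\<^sub>1 a c" if "a \<in> elems A\<^sub>1" "b \<in> elems A\<^sub>1" "c \<in> elems A\<^sub>1" "C\<^sub>1 a (join A\<^sub>1 b c)" for a b c
      using that join_right[of "h a" "h b" "h c"] iff by simp
    show "C\<^sub>1 a c \<or> C\<^sub>1 b c" if "a \<in> elems A\<^sub>1" "b \<in> elems A\<^sub>1" "c \<in> elems A\<^sub>1" "C\<^sub>1 (join A\<^sub>1 a b) c" for a b c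
      using that join_left[of "h a" "h b" "h c"] iff by simp
  qed
qed

text \<open>An unrelated pair is covered by images of an unrelated pair of \<open>A\<^sub>1\<close>;
  the image of the interpolant found there works for the smaller pair too, by monotonicity.\<close>

lemma interpolation_push:
  assumes C: "stable_relation h A\<^sub>1 A\<^sub>2 C\<^sub>1 C\<^sub>2"
    and D: "stable_relation h A\<^sub>1 A\<^sub>2 D\<^sub>1 D\<^sub>2" "precontact_relation A\<^sub>2 D\<^sub>2"
    and E: "stable_relation h A\<^sub>1 A\<^sub>2 E\<^sub>1 E\<^sub>2" "precontact_relation A\<^sub>2 E\<^sub>2"
    and interpolation: "\<And>a b. \<lbrakk>a \<in> elems A\<^sub>1; b \<in> elems A\<^sub>1; \<not> C\<^sub>1 a b\<rbrakk> \<Longrightarrow>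
      \<exists>c\<in>elems A\<^sub>1. \<not> D\<^sub>1 a c \<and> \<not> E\<^sub>1 (compl A\<^sub>1 c) b"
    and ab: "a \<in> elems A\<^sub>2" "b \<in> elems A\<^sub>2" "\<not> C\<^sub>2 a b"
  shows "\<exists>c\<in>elems A\<^sub>2. \<not> D\<^sub>2 a c \<and> \<not> E\<^sub>2 (compl A\<^sub>2 c) b"
proof -
  obtain x y where xy: "x \<in> elems A\<^sub>1" "y \<in> elems A\<^sub>1" "\<not> C\<^sub>1 x y" "below A\<^sub>2 a (h x)" "below A\<^sub>2 b (h y)"
    using stable_cover[OF C ab] .
  then obtain c where c: "c \<in> elems A\<^sub>1" "\<not> D\<^sub>1 x c" "\<not> E\<^sub>1 (compl A\<^sub>1 c) y"
    using interpolation by blast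
  have "\<not> D\<^sub>2 a (h c)"
    using c xy ab stable_iff[OF D(1), of x c]
      precontact_relation.upward_monotone[OF D(2), of a "h c" "h x" "h c"] by auto
  moreover have "\<not> E\<^sub>2 (compl A\<^sub>2 (h c)) b"
    using c xy ab stable_iff[OF E(1), of "compl A\<^sub>1 c" y]
      precontact_relation.upward_monotone[OF E(2), of "compl A\<^sub>2 (h c)" b "compl A\<^sub>2 (h c)" "h y"] by auto
  ultimately show ?thesis
    using c image_closed by blast
qed

text \<open>The interpolant \<open>c\<close> need not be an image, but stability of
  \<open>D\<^sub>2\<close> encloses it in some \<open>h y\<close> that is still unrelated on the
  left. Enlarging \<open>c\<close> shrinks its complement, so the right side survives as
  well.\<close>

lemma interpolation_pull:
  assumes C: "stable_relation h A\<^sub>1 A\<^sub>2 C\<^sub>1 C\<^sub>2"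
    and D: "stable_relation h A\<^sub>1 A\<^sub>2 D\<^sub>1 D\<^sub>2" "precontact_relation A\<^sub>2 D\<^sub>2"
    and E: "stable_relation h A\<^sub>1 A\<^sub>2 E\<^sub>1 E\<^sub>2" "precontact_relation A\<^sub>2 E\<^sub>2"
    and interpolation: "\<And>a b. \<lbrakk>a \<in> elems A\<^sub>2; b \<in> elems A\<^sub>2; \<not> C\<^sub>2 a b\<rbrakk> \<Longrightarrow>
      \<exists>c\<in>elems A\<^sub>2. \<not> D\<^sub>2 a c \<and> \<not> E\<^sub>2 (compl A\<^sub>2 c) b"
    and ab: "a \<in> elems A\<^sub>1" "b \<in> elems A\<^sub>1" "\<not> C\<^sub>1 a b"
  shows "\<exists>c\<in>elems A\<^sub>1. \<not> D\<^sub>1 a c \<and> \<not> E\<^sub>1 (compl A\<^sub>1 c) b"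
proof -
  have "\<not> C\<^sub>2 (h a) (h b)"
    using stable_iff[OF C] ab by blast
  then obtain c where c: "c \<in> elems A\<^sub>2" "\<not> D\<^sub>2 (h a) c" "\<not> E\<^sub>2 (compl A\<^sub>2 c) (h b)"
    using interpolation[of "h a" "h b"] ab by auto
  obtain x y where xy: "x \<in> elems A\<^sub>1" "y \<in> elems A\<^sub>1" "\<not> D\<^sub>1 x y" "below A\<^sub>2 (h a) (h x)" "below A\<^sub>2 c (h y)"
    using stable_cover[OF D(1) _ c(1,2)] ab by auto
  have "\<not> D\<^sub>1 a y"
    using xy ab precontact_relation.upward_monotone[OF precontact_pullback[OF D], of a y x y] by auto
  moreover have "below A\<^sub>2 (compl A\<^sub>2 (h y)) (compl A\<^sub>2 c)"
    using xy c tgt.compl_antimono by simp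
  then have "\<not> E\<^sub>1 (compl A\<^sub>1 y) b"
    using xy c ab stable_iff[OF E(1), of "compl A\<^sub>1 y" b]
      precontact_relation.upward_monotone[OF E(2), of "compl A\<^sub>2 (h y)" "h b" "compl A\<^sub>2 c" "h b"] by auto
  ultimately show ?thesis
    using xy by blast
qed

text \<open>Apart from \<open>Tr\<close>, passing from \<open>A\<^sub>2\<close> to
  \<open>A\<^sub>1\<close> is restriction to images. In the other direction, \<open>RS\<close>,
  \<open>LS\<close>, \<open>Lin\<close> and \<open>Tri\<close> approximate nonzero elements from
  below by density, while \<open>Up_Dir\<close>, \<open>Down_Dir\<close>, \<open>Circ\<close>,
  \<open>Dens\<close> and \<open>Ref\<close> cover a counterexample from above by one in
  \<open>A\<^sub>1\<close>.\<close>

theorem holds_iff: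
  assumes P: "stable_relation h A\<^sub>1 A\<^sub>2 (precedence A\<^sub>1) (precedence A\<^sub>2)"
      "precontact_relation A\<^sub>2 (precedence A\<^sub>2)"
    and T: "stable_relation h A\<^sub>1 A\<^sub>2 (time_contact A\<^sub>1) (time_contact A\<^sub>2)"
      "precontact_relation A\<^sub>2 (time_contact A\<^sub>2)"
  shows "holds A\<^sub>1 \<phi> \<longleftrightarrow> holds A\<^sub>2 \<phi>"
proof -
  let ?P1 = "precedence A\<^sub>1" and ?P2 = "precedence A\<^sub>2"
  let ?T1 = "time_contact A\<^sub>1" and ?T2 = "time_contact A\<^sub>2"
  note P_iff = stable_iff[OF P(1)] and T_iff = stable_iff[OF T(1)]
  note P_up1 = precontact_relation.upward_monotone[OF precontact_pullback[OF P]]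
  note P_up2 = precontact_relation.upward_monotone[OF P(2)]
  note T_up2 = precontact_relation.upward_monotone[OF T(2)]
  have P_push: "?P2 a b"
    if "?P1 x y" "x \<in> elems A\<^sub>1" "y \<in> elems A\<^sub>1" "below A\<^sub>2 (h x) a" "below A\<^sub>2 (h y) b"
      "a \<in> elems A\<^sub>2" "b \<in> elems A\<^sub>2" for a b x y
    using that P_iff P_up2[of "h x" "h y" a b] by simp
  have P_pull: "?P1 x y"
    if "?P2 a b" "x \<in> elems A\<^sub>1" "y \<in> elems A\<^sub>1" "below A\<^sub>2 a (h x)" "below A\<^sub>2 b (h y)"
      "a \<in> elems A\<^sub>2" "b \<in> elems A\<^sub>2" for a b x y
    using that P_iff P_up2[of a b "h x" "h y"] by simp
  have T_push: "?T2 a b"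
    if "?T1 x y" "x \<in> elems A\<^sub>1" "y \<in> elems A\<^sub>1" "below A\<^sub>2 (h x) a" "below A\<^sub>2 (h y) b"
      "a \<in> elems A\<^sub>2" "b \<in> elems A\<^sub>2" for a b x y
    using that T_iff T_up2[of "h x" "h y" a b] by simp
  have T_pull: "?T1 x y"
    if "?T2 a b" "x \<in> elems A\<^sub>1" "y \<in> elems A\<^sub>1" "below A\<^sub>2 a (h x)" "below A\<^sub>2 b (h y)"
      "a \<in> elems A\<^sub>2" "b \<in> elems A\<^sub>2" for a b x y
    using that T_iff T_up2[of a b "h x" "h y"] by simp
  have nonzero: "x \<noteq> zero A\<^sub>1"
    if "a \<noteq> zero A\<^sub>2" "below A\<^sub>2 a (h x)" "a \<in> elems A\<^sub>2" "x \<in> elems A\<^sub>1" for a x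
    using that tgt.below_zero by force
  \<comment> \<open>Stability covers \<open>p\<close> by \<open>h q\<close> and its complement by
    \<open>h r\<close>; \<open>complementary_cover\<close> then replaces \<open>r\<close> by the
    complement of \<open>q\<close>. The two variants that follow differ in the sides on which
    \<open>p\<close> and its complement stand.\<close>
  have covers:
    "\<exists>x\<in>elems A\<^sub>1. \<exists>y\<in>elems A\<^sub>1. \<exists>q\<in>elems A\<^sub>1.
       \<not> ?P1 x q \<and> \<not> ?P1 y (compl A\<^sub>1 q) \<and> below A\<^sub>2 a (h x) \<and> below A\<^sub>2 b (h y)"
    if prems: "\<not> ?P2 a p" "\<not> ?P2 b (compl A\<^sub>2 p)" "a \<in> elems A\<^sub>2" "b \<in> elems A\<^sub>2" "p \<in> elems A\<^sub>2" for a b p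
  proof -
    obtain x q where xq: "x \<in> elems A\<^sub>1" "q \<in> elems A\<^sub>1" "\<not> ?P1 x q" "below A\<^sub>2 a (h x)" "below A\<^sub>2 p (h q)"
      using stable_cover[OF P(1)] prems by metis
    obtain y r where yr: "y \<in> elems A\<^sub>1" "r \<in> elems A\<^sub>1" "\<not> ?P1 y r" "below A\<^sub>2 b (h y)"
        "below A\<^sub>2 (compl A\<^sub>2 p) (h r)"
      using stable_cover[OF P(1)] prems tgt.compl_closed by metis
    have "\<not> ?P1 y (compl A\<^sub>1 q)"
      using P_up1[of y "compl A\<^sub>1 q" y r] complementary_cover[of p q r] xq yr prems by auto
    then show ?thesis
      using xq yr by blast
  qed
  have covers_mixed:
    "\<exists>x\<in>elems A\<^sub>1. \<exists>y\<in>elems A\<^sub>1. \<exists>q\<in>elems A\<^sub>1.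
       \<not> ?P1 x q \<and> \<not> ?P1 (compl A\<^sub>1 q) y \<and> below A\<^sub>2 a (h x) \<and> below A\<^sub>2 b (h y)"
    if prems: "\<not> ?P2 a p" "\<not> ?P2 (compl A\<^sub>2 p) b" "a \<in> elems A\<^sub>2" "b \<in> elems A\<^sub>2" "p \<in> elems A\<^sub>2" for a b p
  proof -
    obtain x q where xq: "x \<in> elems A\<^sub>1" "q \<in> elems A\<^sub>1" "\<not> ?P1 x q" "below A\<^sub>2 a (h x)" "below A\<^sub>2 p (h q)"
      using stable_cover[OF P(1)] prems by metis
    obtain y r where yr: "y \<in> elems A\<^sub>1" "r \<in> elems A\<^sub>1" "\<not> ?P1 r y" "below A\<^sub>2 b (h y)"
        "below A\<^sub>2 (compl A\<^sub>2 p) (h r)"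
      using stable_cover[OF P(1)] prems tgt.compl_closed by metis
    have "\<not> ?P1 (compl A\<^sub>1 q) y"
      using P_up1[of "compl A\<^sub>1 q" y r y] complementary_cover[of p q r] xq yr prems by auto
    then show ?thesis
      using xq yr by blast
  qed
  have covers_left:
    "\<exists>x\<in>elems A\<^sub>1. \<exists>y\<in>elems A\<^sub>1. \<exists>q\<in>elems A\<^sub>1.
       \<not> ?P1 q x \<and> \<not> ?P1 (compl A\<^sub>1 q) y \<and> below A\<^sub>2 a (h x) \<and> below A\<^sub>2 b (h y)"
    if prems: "\<not> ?P2 p a" "\<not> ?P2 (compl A\<^sub>2 p) b" "a \<in> elems A\<^sub>2" "b \<in> elems A\<^sub>2" "p \<in> elems A\<^sub>2" for a b p
  proof -
    obtain x q where xq: "x \<in> elems A\<^sub>1" "q \<in> elems A\<^sub>1" "\<not> ?P1 q x" "below A\<^sub>2 a (h x)" "below A\<^sub>2 p (h q)"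
      using stable_cover[OF P(1)] prems by metis
    obtain y r where yr: "y \<in> elems A\<^sub>1" "r \<in> elems A\<^sub>1" "\<not> ?P1 r y" "below A\<^sub>2 b (h y)"
        "below A\<^sub>2 (compl A\<^sub>2 p) (h r)"
      using stable_cover[OF P(1)] prems tgt.compl_closed by metis
    have "\<not> ?P1 (compl A\<^sub>1 q) y"
      using P_up1[of "compl A\<^sub>1 q" y r y] complementary_cover[of p q r] xq yr prems by auto
    then show ?thesis
      using xq yr by blast
  qed
  show ?thesis
  proof (cases \<phi>)
    case RS
    show ?thesis
    proof
      assume A1: "holds A\<^sub>1 \<phi>"
      have "?P2 a (one A\<^sub>2)" if "a \<in> elems A\<^sub>2" "a \<noteq> zero A\<^sub>2" for a
        using dense[OF that] A1 that P_push[of _ "one A\<^sub>1" a "one A\<^sub>2"] by (auto simp: RS)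
      then show "holds A\<^sub>2 \<phi>"
        by (simp add: RS)
    next
      assume "holds A\<^sub>2 \<phi>"
      then show "holds A\<^sub>1 \<phi>"
        by (simp add: RS P_iff)
    qed
  next
    case LS
    show ?thesis
    proof
      assume A1: "holds A\<^sub>1 \<phi>"
      have "?P2 (one A\<^sub>2) a" if "a \<in> elems A\<^sub>2" "a \<noteq> zero A\<^sub>2" for a
        using dense[OF that] A1 that P_push[of "one A\<^sub>1" _ "one A\<^sub>2" a] by (auto simp: LS)
      then show "holds A\<^sub>2 \<phi>"
        by (simp add: LS)
    next
      assume "holds A\<^sub>2 \<phi>"
      then show "holds A\<^sub>1 \<phi>"
        by (simp add: LS P_iff)
    qed
  next
    case Up_Dir
    show ?thesis
    proof
      assume A1: "holds A\<^sub>1 \<phi>"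
      have "?P2 a p \<or> ?P2 b (compl A\<^sub>2 p)"
        if "a \<in> elems A\<^sub>2" "b \<in> elems A\<^sub>2" "p \<in> elems A\<^sub>2" "a \<noteq> zero A\<^sub>2" "b \<noteq> zero A\<^sub>2" for a b p
        using covers[of a p b] that nonzero A1 unfolding Up_Dir holds.simps by metis
      then show "holds A\<^sub>2 \<phi>"
        by (simp add: Up_Dir)
    next
      assume "holds A\<^sub>2 \<phi>"
      then show "holds A\<^sub>1 \<phi>"
        by (simp add: Up_Dir P_iff)
    qed
  next
    case Down_Dir
    show ?thesis
    proof
      assume A1: "holds A\<^sub>1 \<phi>"
      have "?P2 p a \<or> ?P2 (compl A\<^sub>2 p) b"
        if "a \<in> elems A\<^sub>2" "b \<in> elems A\<^sub>2" "p \<in> elems A\<^sub>2" "a \<noteq> zero A\<^sub>2" "b \<noteq> zero A\<^sub>2" for a b p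
        using covers_left[of p a b] that nonzero A1 unfolding Down_Dir holds.simps by metis
      then show "holds A\<^sub>2 \<phi>"
        by (simp add: Down_Dir)
    next
      assume "holds A\<^sub>2 \<phi>"
      then show "holds A\<^sub>1 \<phi>"
        by (simp add: Down_Dir P_iff)
    qed
  next
    case Circ
    show ?thesis
    proof
      assume A1: "holds A\<^sub>1 \<phi>"
      \<comment> \<open>If both disjuncts failed, the covers of \<open>b\<close> and
        \<open>a\<close> would refute the axiom in \<open>A\<^sub>1\<close>, since
        \<open>P_pull\<close> lifts the premise to these covers.\<close>
      have "?P2 b p \<or> ?P2 (compl A\<^sub>2 p) a"
        if "a \<in> elems A\<^sub>2" "b \<in> elems A\<^sub>2" "p \<in> elems A\<^sub>2" "?P2 a b" for a b p
        using covers_mixed[of b p a] that P_pull[OF that(4)] A1 unfolding Circ holds.simps by metis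
      then show "holds A\<^sub>2 \<phi>"
        by (simp add: Circ)
    next
      assume "holds A\<^sub>2 \<phi>"
      then show "holds A\<^sub>1 \<phi>"
        by (simp add: Circ P_iff)
    qed
  next
    case Dens
    show ?thesis
    proof
      assume A1: "holds A\<^sub>1 \<phi>"
      have "?P2 a p \<or> ?P2 (compl A\<^sub>2 p) b"
        if "a \<in> elems A\<^sub>2" "b \<in> elems A\<^sub>2" "p \<in> elems A\<^sub>2" "?P2 a b" for a b p
        using covers_mixed[of a p b] that P_pull[OF that(4)] A1 unfolding Dens holds.simps by metis
      then show "holds A\<^sub>2 \<phi>"
        by (simp add: Dens)
    next
      assume "holds A\<^sub>2 \<phi>"
      then show "holds A\<^sub>1 \<phi>"
        by (simp add: Dens P_iff)
    qed
  next
    case Ref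
    show ?thesis
    proof
      assume A1: "holds A\<^sub>1 \<phi>"
      have "?P2 a b" if "a \<in> elems A\<^sub>2" "b \<in> elems A\<^sub>2" "?T2 a b" for a b
        using stable_cover[OF P(1) that(1,2)] T_pull[OF that(3)] that A1
        unfolding Ref holds.simps by metis
      then show "holds A\<^sub>2 \<phi>"
        by (simp add: Ref)
    next
      assume "holds A\<^sub>2 \<phi>"
      then show "holds A\<^sub>1 \<phi>"
        by (simp add: Ref P_iff T_iff)
    qed
  next
    case Lin
    show ?thesis
    proof
      assume A1: "holds A\<^sub>1 \<phi>"
      have "?P2 a b \<or> ?P2 b a"
        if "a \<in> elems A\<^sub>2" "b \<in> elems A\<^sub>2" "a \<noteq> zero A\<^sub>2" "b \<noteq> zero A\<^sub>2" for a b
        using dense[of a] dense[of b] that P_push A1 unfolding Lin holds.simps by metis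
      then show "holds A\<^sub>2 \<phi>"
        by (simp add: Lin)
    next
      assume "holds A\<^sub>2 \<phi>"
      then show "holds A\<^sub>1 \<phi>"
        by (simp add: Lin P_iff)
    qed
  next
    case Tri
    show ?thesis
    proof
      assume A1: "holds A\<^sub>1 \<phi>"
      have "?T2 a b \<or> ?P2 a b \<or> ?P2 b a"
        if "a \<in> elems A\<^sub>2" "b \<in> elems A\<^sub>2" "a \<noteq> zero A\<^sub>2" "b \<noteq> zero A\<^sub>2" for a b
        using dense[of a] dense[of b] that P_push T_push A1 unfolding Tri holds.simps by metis
      then show "holds A\<^sub>2 \<phi>"
        by (simp add: Tri)
    next
      assume "holds A\<^sub>2 \<phi>"
      then show "holds A\<^sub>1 \<phi>"
        by (simp add: Tri P_iff T_iff)
    qed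
  next
    case Tr
    \<comment> \<open>This axiom is the interpolation schema with precedence in all three
      places.\<close>
    show ?thesis
      using interpolation_push[OF P(1) P P] interpolation_pull[OF P(1) P P]
      unfolding Tr holds.simps by blast
  qed
qed

end

section \<open>The canonical space\<close>

context dynamic_contact_algebra
begin

section \<open>The canonical topology and the Boolean embedding\<close>

abbreviation "X \<equiv> space_topology (canonical_space A)"

abbreviation "K \<equiv> RC (canonical_space A)"

lemma prime_filter_t_clan: "prime_filter U \<Longrightarrow> U \<in> t_clans A"
  using clan_prime_filter[OF time_contact] by (simp add: t_clans_def)

lemma canonical_space_simps [simp]:
  "topspace X = t_clans A"
  "space_points (canonical_space A) = s_clans A"
  "closed_base (canonical_space A) = g_map A ` elems A"
  "point_before (canonical_space A) \<Gamma> \<Delta> \<longleftrightarrow> (\<forall>a\<in>\<Gamma>. \<forall>b\<in>\<Delta>. precedence A a b)"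
  using topspace_canonical_space by (simp_all add: canonical_space_def)

lemma g_map_zero [simp]: "g_map A \<zero> = {}"
  by (auto simp: g_map_def t_clans_def clan_def)

lemma g_map_one [simp]: "g_map A \<one> = t_clans A"
  by (auto simp: g_map_def t_clans_def clan_def)

text \<open>A prime filter separating \<open>a\<close> from \<open>b\<close> is a t-clan, hence a
  point of the space that refutes the inclusion.\<close>

lemma g_map_subset_iff:
  assumes "a \<in> elems A" "b \<in> elems A"
  shows "g_map A a \<subseteq> g_map A b \<longleftrightarrow> below A a b"
proof
  assume sub: "g_map A a \<subseteq> g_map A b"
  show "below A a b"
  proof (rule ccontr)
    assume "\<not> below A a b"
    then obtain U where U: "prime_filter U" "a \<in> U" "b \<notin> U"
      using prime_filter_separation[OF assms] by blast
    then show False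
      using sub prime_filter_t_clan[OF U(1)] by (auto simp: g_map_def)
  qed
next
  assume "below A a b"
  then show "g_map A a \<subseteq> g_map A b"
    using assms unfolding g_map_def t_clans_def clan_def by blast
qed

lemma closedin_g_map:
  assumes "a \<in> elems A"
  shows "closedin X (g_map A a)"
proof -
  have "openin X (t_clans A - g_map A a)"
    unfolding openin_canonical_space using assms by (intro exI[of _ "{g_map A a}"]) auto
  moreover have "g_map A a \<subseteq> t_clans A"
    by (auto simp: g_map_def)
  ultimately show ?thesis
    by (simp add: closedin_def)
qed

text \<open>The working form of the closed base: the complement of \<open>S\<close> is a union of
  complements of basic sets, and one of these contains \<Gamma>.\<close>

lemma closedin_canonical_separation:
  assumes "closedin X S" "\<Gamma> \<in> t_clans A" "\<Gamma> \<notin> S"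
  obtains d where "d \<in> elems A" "S \<subseteq> g_map A d" "\<Gamma> \<notin> g_map A d"
proof -
  have S: "S \<subseteq> t_clans A" "openin X (t_clans A - S)"
    using assms(1) by (auto simp: closedin_def)
  then obtain F where F: "F \<subseteq> g_map A ` elems A" "t_clans A - S = (\<Union>m\<in>F. t_clans A - m)"
    unfolding openin_canonical_space by blast
  have "\<Gamma> \<in> (\<Union>m\<in>F. t_clans A - m)"
    using assms F(2) by blast
  then obtain m where m: "m \<in> F" "\<Gamma> \<notin> m"
    by blast
  then obtain d where "d \<in> elems A" "m = g_map A d"
    using F(1) by blast
  moreover have "t_clans A - m \<subseteq> t_clans A - S"
    unfolding F(2) using m by blast
  ultimately show thesis
    using that m S by blast
qed

text \<open>A basic set \<open>g_map A d\<close> includes the complement of \<open>g_map A a\<close>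
  iff \<open>a \<oplus> d\<close> is the unit, that is, iff \<open>compl A a\<close> is below
  \<open>d\<close>. So \<open>g_map A (compl A a)\<close> is the least basic set including it, and
  basic sets determine closures.\<close>

lemma closure_of_compl_g_map:
  assumes "a \<in> elems A"
  shows "X closure_of (t_clans A - g_map A a) = g_map A (compl A a)"
proof
  show "X closure_of (t_clans A - g_map A a) \<subseteq> g_map A (compl A a)"
    using g_map_join[of a "compl A a"] assms
    by (intro closure_of_minimal closedin_g_map) (auto simp: join_compl)
  show "g_map A (compl A a) \<subseteq> X closure_of (t_clans A - g_map A a)"
  proof (rule ccontr)
    assume "\<not> ?thesis"
    then obtain \<Gamma> where \<Gamma>: "\<Gamma> \<in> g_map A (compl A a)" "\<Gamma> \<notin> X closure_of (t_clans A - g_map A a)"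
      by blast
    moreover have "\<Gamma> \<in> t_clans A"
      using \<Gamma>(1) by (simp add: g_map_def)
    ultimately obtain d where d: "d \<in> elems A" "X closure_of (t_clans A - g_map A a) \<subseteq> g_map A d"
        "\<Gamma> \<notin> g_map A d"
      using closedin_canonical_separation[OF closedin_closure_of] by metis
    have "t_clans A - g_map A a \<subseteq> g_map A d"
      using d(2) closure_of_subset[of "t_clans A - g_map A a" X] by simp
    then have "g_map A \<one> \<subseteq> g_map A (a \<oplus> d)"
      using assms d by (auto simp: g_map_join)
    then have "below A \<one> (a \<oplus> d)"
      using assms d by (subst (asm) g_map_subset_iff) auto
    then have "a \<oplus> d = \<one>"
      using assms d by (simp add: below_antisym)
    then have "g_map A (compl A a) \<subseteq> g_map A d"
      using assms d by (simp add: g_map_subset_iff compl_below_iff)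
    then show False
      using \<Gamma> d by blast
  qed
qed

text \<open>By double complement, this is the closure of the open complement of
  \<open>g_map A (compl A a)\<close>.\<close>

lemma g_map_RC:
  assumes "a \<in> elems A"
  shows "g_map A a \<in> elems K"
proof -
  have "openin X (t_clans A - g_map A (compl A a))"
    using closedin_g_map[of "compl A a"] assms by (simp add: closedin_def)
  from closure_of_openin_RC[OF this] show ?thesis
    using closure_of_compl_g_map[of "compl A a"] assms by (simp del: RC_simps)
qed

text \<open>Clans need not be closed under meets, so the meet is reached through complements: the
  interior of the intersection is the complement of \<open>g_map A ?c\<close>.\<close>

lemma g_map_meet:
  assumes "a \<in> elems A" "b \<in> elems A"
  shows "g_map A (a \<odot> b) = meet K (g_map A a) (g_map A b)"
proof -
  let ?c = "compl A a \<oplus> compl A b"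
  have "X closure_of (t_clans A - g_map A a \<inter> g_map A b) = g_map A ?c"
    using assms closure_of_compl_g_map[of a] closure_of_compl_g_map[of b]
    by (simp add: Diff_Int closure_of_Un g_map_join)
  then have "X interior_of (g_map A a \<inter> g_map A b) = t_clans A - g_map A ?c"
    by (simp add: interior_of_closure_of)
  then show ?thesis
    using assms closure_of_compl_g_map[of ?c] compl_join_compl[OF assms] by simp
qed

lemma g_map_homomorphism: "boolean_homomorphism (g_map A) A K"
  unfolding boolean_homomorphism_def
proof (intro conjI ballI)
  show "g_map A ` elems A \<subseteq> elems K"
    using g_map_RC by blast
  show "g_map A (compl A a) = compl K (g_map A a)" if "a \<in> elems A" for a
    using closure_of_compl_g_map[OF that] by simp
qed (simp_all add: g_map_join g_map_meet)

lemma inj_on_g_map: "inj_on (g_map A) (elems A)"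
proof (rule inj_onI)
  fix a b
  assume "a \<in> elems A" "b \<in> elems A" "g_map A a = g_map A b"
  then show "a = b"
    using g_map_subset_iff[of a b] g_map_subset_iff[of b a] below_antisym by simp
qed

lemma RC_boolean: "nontrivial_boolean_algebra K"
proof -
  \<comment> \<open>The space has a point because \<open>g_map\<close> is injective and zero differs
    from one.\<close>
  have "g_map A \<one> \<noteq> g_map A \<zero>"
    using inj_onD[OF inj_on_g_map, of \<one> \<zero>] zero_neq_one by auto
  then show ?thesis
    by (intro RC_boolean_algebra) simp
qed

text \<open>The interior of \<open>a\<close> is nonempty and so includes a nonempty complement of a
  basic set. The closure of that complement is again basic, and it stays inside \<open>a\<close>,
  the closure of its own interior.\<close>

lemma g_map_dense:
  assumes "a \<in> elems K" "a \<noteq> {}"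
  obtains c where "c \<in> elems A" "c \<noteq> \<zero>" "g_map A c \<subseteq> a"
proof -
  have "X interior_of a \<noteq> {}"
    using assms by auto
  moreover have "openin X (X interior_of a)"
    by simp
  then obtain F where F: "F \<subseteq> g_map A ` elems A" "X interior_of a = (\<Union>m\<in>F. t_clans A - m)"
    unfolding openin_canonical_space by blast
  ultimately obtain m where m: "m \<in> F" "t_clans A - m \<noteq> {}"
    by blast
  then obtain c where "c \<in> elems A" "m = g_map A c"
    using F(1) by blast
  moreover have "t_clans A - m \<subseteq> X interior_of a"
    unfolding F(2) using m(1) by blast
  ultimately have c: "c \<in> elems A" "t_clans A - g_map A c \<subseteq> X interior_of a"
    "t_clans A - g_map A c \<noteq> {}"
    using m by simp_all
  have "g_map A (compl A c) \<subseteq> X closure_of (X interior_of a)"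
    using c closure_of_mono[OF c(2), of X] by (simp add: closure_of_compl_g_map)
  then have "g_map A (compl A c) \<subseteq> a"
    using assms by simp
  moreover have "compl A c \<noteq> \<zero>"
    using c closure_of_subset[of "t_clans A - g_map A c" X] by (auto simp: closure_of_compl_g_map)
  ultimately show thesis
    using c(1) that[of "compl A c"] by simp
qed

section \<open>Points of regular closed sets obtained from filters\<close>

lemma filter_of_RC:
  assumes "a \<in> elems K"
  shows "lattice_filter {x \<in> elems A. a \<subseteq> g_map A x}"
proof -
  have "a \<subseteq> g_map A (x \<odot> y)" if "x \<in> elems A" "y \<in> elems A" "a \<subseteq> g_map A x" "a \<subseteq> g_map A y" for x y
    using that assms g_map_RC by (simp add: RC_meet_greatest g_map_meet del: RC_simps)
  moreover have "a \<subseteq> t_clans A"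
    using assms by simp
  moreover have "a \<subseteq> g_map A y" if "a \<subseteq> g_map A x" "x \<in> elems A" "y \<in> elems A" "below A x y" for x y
    using that g_map_subset_iff by blast
  ultimately show ?thesis
    unfolding lattice_filter_def by simp blast
qed

lemma RC_memI:
  assumes "a \<in> elems K" "\<Gamma> \<in> t_clans A" "{x \<in> elems A. a \<subseteq> g_map A x} \<subseteq> \<Gamma>"
  shows "\<Gamma> \<in> a"
proof (rule ccontr)
  assume "\<Gamma> \<notin> a"
  then obtain d where "d \<in> elems A" "a \<subseteq> g_map A d" "\<Gamma> \<notin> g_map A d"
    using closedin_canonical_separation[OF RC_closedin[OF assms(1)] assms(2)] by blast
  then show False
    using assms by (auto simp: g_map_def)
qed

text \<open>The union of the two prime filters includes both filters of basic covers, so it belongs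
  to both sets once it is a point. \<open>C_le\<close> makes it a t-clan, which lets one argument
  serve time and space contact.\<close>

lemma RC_contact_point:
  assumes C: "contact_relation A C"
    and C_le: "\<And>x y. \<lbrakk>x \<in> elems A; y \<in> elems A; C x y\<rbrakk> \<Longrightarrow> time_contact A x y"
    and ab: "a \<in> elems K" "b \<in> elems K"
    and rel: "\<And>x y. \<lbrakk>x \<in> elems A; y \<in> elems A; a \<subseteq> g_map A x; b \<subseteq> g_map A y\<rbrakk> \<Longrightarrow> C x y"
  shows "\<exists>\<Gamma>. \<Gamma> \<in> a \<and> \<Gamma> \<in> b \<and> clan A C \<Gamma>"
proof -
  obtain U V where UV: "prime_filter U" "prime_filter V"
    "{x \<in> elems A. a \<subseteq> g_map A x} \<subseteq> U" "{x \<in> elems A. b \<subseteq> g_map A x} \<subseteq> V"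
    "\<And>x y. x \<in> U \<Longrightarrow> y \<in> V \<Longrightarrow> C x y"
    using prime_filter_pair_extension[OF contact_relation.axioms(1)[OF C]
        filter_of_RC[OF ab(1)] filter_of_RC[OF ab(2)]]
      rel by (metis (mono_tags, lifting) mem_Collect_eq)
  have clan: "clan A C (U \<union> V)"
    by (rule clan_union_prime_filters[OF C UV(1,2,5)])
  then have "time_contact A x y" if "x \<in> U \<union> V" "y \<in> U \<union> V" for x y
    using that C_le[of x y] unfolding clan_def by blast
  then have "U \<union> V \<in> t_clans A"
    using clan by (simp add: t_clans_def clan_def)
  then have "U \<union> V \<in> a" "U \<union> V \<in> b"
    using RC_memI ab UV by blast+
  then show ?thesis
    using clan by blast
qed

text \<open>No union is formed here: \<open>U\<close> and \<open>V\<close> stay separate points, one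
  in each set, and their members being related is exactly \<open>point_before\<close>.\<close>

lemma RC_precedence_points:
  assumes ab: "a \<in> elems K" "b \<in> elems K"
    and rel: "\<And>x y. \<lbrakk>x \<in> elems A; y \<in> elems A; a \<subseteq> g_map A x; b \<subseteq> g_map A y\<rbrakk> \<Longrightarrow> precedence A x y"
  shows "precedence K a b"
proof -
  obtain U V where UV: "prime_filter U" "prime_filter V"
    "{x \<in> elems A. a \<subseteq> g_map A x} \<subseteq> U" "{x \<in> elems A. b \<subseteq> g_map A x} \<subseteq> V"
    "\<And>x y. x \<in> U \<Longrightarrow> y \<in> V \<Longrightarrow> precedence A x y"
    using prime_filter_pair_extension[OF precedence filter_of_RC[OF ab(1)] filter_of_RC[OF ab(2)]]
      rel by (metis (mono_tags, lifting) mem_Collect_eq)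
  then have "U \<in> a" "V \<in> b"
    using RC_memI ab prime_filter_t_clan by blast+
  then show ?thesis
    using UV(5) by auto
qed

section \<open>Stability of the three relations\<close>

lemma stable_relation_RC:
  assumes C: "precontact_relation A C"
    and sound: "\<And>a b x y. \<lbrakk>D a b; x \<in> elems A; y \<in> elems A; a \<subseteq> g_map A x; b \<subseteq> g_map A y\<rbrakk> \<Longrightarrow> C x y"
    and complete: "\<And>a b. \<lbrakk>a \<in> elems K; b \<in> elems K;
      \<And>x y. \<lbrakk>x \<in> elems A; y \<in> elems A; a \<subseteq> g_map A x; b \<subseteq> g_map A y\<rbrakk> \<Longrightarrow> C x y\<rbrakk> \<Longrightarrow> D a b"
  shows "stable_relation (g_map A) A K C D"
proof -
  interpret precontact_relation A C by fact
  have "C x y \<longleftrightarrow> D (g_map A x) (g_map A y)" if xy: "x \<in> elems A" "y \<in> elems A" for x y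
  proof
    \<comment> \<open>Inclusion of basic sets is the order of \<open>A\<close>, so by monotonicity
      \<open>C\<close> holds for all basic covers of the two sets and \<open>complete\<close>
      applies.\<close>
    assume "C x y"
    then show "D (g_map A x) (g_map A y)"
      using xy upward_monotone g_map_subset_iff g_map_RC by (intro complete) blast+
  next
    assume "D (g_map A x) (g_map A y)"
    then show "C x y"
      using sound xy by blast
  qed
  \<comment> \<open>The contrapositive of \<open>complete\<close> is the covering clause of
    stability.\<close>
  then show ?thesis
    using complete unfolding stable_relation_def below_RC by blast
qed

lemma time_contact_stable: "stable_relation (g_map A) A K (time_contact A) (time_contact K)"
proof (rule stable_relation_RC)
  show "precontact_relation A (time_contact A)"
    using time_contact by (rule contact_relation.axioms)
  show "time_contact A x y"
    if "time_contact K a b" "a \<subseteq> g_map A x" "b \<subseteq> g_map A y" for a b x y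
  proof -
    from that obtain \<Gamma> where "\<Gamma> \<in> g_map A x" "\<Gamma> \<in> g_map A y"
      by auto
    then show ?thesis
      by (simp add: g_map_def t_clans_def clan_def)
  qed
  show "time_contact K a b"
    if "a \<in> elems K" "b \<in> elems K"
      "\<And>x y. \<lbrakk>x \<in> elems A; y \<in> elems A; a \<subseteq> g_map A x; b \<subseteq> g_map A y\<rbrakk> \<Longrightarrow> time_contact A x y" for a b
    using RC_contact_point[OF time_contact _ that] unfolding RC_simps by blast
qed

lemma space_contact_stable: "stable_relation (g_map A) A K (space_contact A) (space_contact K)"
proof (rule stable_relation_RC)
  show "precontact_relation A (space_contact A)"
    using space_contact by (rule contact_relation.axioms)
  show "space_contact A x y"
    if "space_contact K a b" "a \<subseteq> g_map A x" "b \<subseteq> g_map A y" for a b x y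
  proof -
    from that obtain \<Gamma> where "\<Gamma> \<in> g_map A x" "\<Gamma> \<in> g_map A y" "\<Gamma> \<in> s_clans A"
      by auto
    then show ?thesis
      by (simp add: g_map_def s_clans_def clan_def)
  qed
  show "space_contact K a b"
    if "a \<in> elems K" "b \<in> elems K"
      "\<And>x y. \<lbrakk>x \<in> elems A; y \<in> elems A; a \<subseteq> g_map A x; b \<subseteq> g_map A y\<rbrakk> \<Longrightarrow> space_contact A x y" for a b
    using RC_contact_point[OF space_contact space_imp_time that]
    unfolding RC_simps canonical_space_simps s_clans_def by blast
qed

lemma precedence_stable: "stable_relation (g_map A) A K (precedence A) (precedence K)"
proof (rule stable_relation_RC[OF precedence _ RC_precedence_points])
  show "precedence A x y"
    if "precedence K a b" "a \<subseteq> g_map A x" "b \<subseteq> g_map A y" for a b x y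
    using that by (fastforce simp: g_map_def)
qed

lemma g_map_stable_embedding: "stable_embedding A K (g_map A)"
proof -
  interpret K: nontrivial_boolean_algebra K
    by (rule RC_boolean)
  show ?thesis
    using g_map_homomorphism inj_on_g_map g_map_dense
    by unfold_locales (auto simp del: RC_simps(1))
qed

section \<open>The algebra of regular closed sets as a dynamic contact algebra\<close>

lemma RC_time_contact: "contact_relation K (time_contact K)"
proof (intro contact_relation.intro contact_relation_axioms.intro)
  show "precontact_relation K (time_contact K)"
    by (rule RC_precontact[where R = "(=)"]) auto
  show "time_contact K b a" if "time_contact K a b" for a b
    using that by (simp add: Int_commute)
  show "time_contact K a b" if "meet K a b \<noteq> zero K" for a b
    using that interior_of_subset[of X "a \<inter> b"] by force
qed

lemma RC_space_contact: "contact_relation K (space_contact K)"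
proof (intro contact_relation.intro contact_relation_axioms.intro)
  show "precontact_relation K (space_contact K)"
    by (rule RC_precontact[where R = "\<lambda>x y. x = y \<and> x \<in> s_clans A"]) auto
  show "space_contact K b a" if "space_contact K a b" for a b
    using that by (simp add: Int_commute)
  show "space_contact K a b"
    if ab: "a \<in> elems K" "b \<in> elems K" "meet K a b \<noteq> zero K" for a b
  proof -
    \<comment> \<open>A common point must be found that is an s-clan. Density puts a nonzero
      \<open>c\<close> under the meet, and a prime filter containing \<open>c\<close> is both a
      t-clan and an s-clan.\<close>
    obtain c where c: "c \<in> elems A" "c \<noteq> \<zero>" "g_map A c \<subseteq> meet K a b"
      using g_map_dense[OF RC_meet_closed] ab(3) RC_simps(5) by metis
    then have "\<not> below A c \<zero>"
      using below_zero by blast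
    then obtain U where U: "prime_filter U" "c \<in> U"
      using prime_filter_separation[OF c(1) zero_closed] by blast
    then have "U \<in> g_map A c"
      using prime_filter_t_clan by (simp add: g_map_def)
    then have "U \<in> a" "U \<in> b"
      using RC_meet_greatest[OF g_map_RC[OF c(1)] ab(1,2)] c(3) by blast+
    moreover have "U \<in> s_clans A"
      using clan_prime_filter[OF space_contact U(1)] by (simp add: s_clans_def)
    ultimately show ?thesis
      by auto
  qed
qed

lemma RC_precedence: "precontact_relation K (precedence K)"
  by (rule RC_precontact) (rule RC_simps)

theorem RC_dynamic_contact_algebra: "dynamic_contact_algebra K"
proof -
  interpret emb: stable_embedding A K "g_map A"
    by (rule g_map_stable_embedding)
  note T = time_contact_stable contact_relation.axioms(1)[OF RC_time_contact]
  note P = precedence_stable RC_precedence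
  show ?thesis
  proof (intro dynamic_contact_algebra.intro dynamic_contact_algebra_axioms.intro)
    fix a b
    assume ab: "a \<in> elems K" "b \<in> elems K"
    show "time_contact K a b" if "space_contact K a b"
      using that by auto
    show "\<exists>c\<in>elems K. \<not> time_contact K a c \<and> \<not> time_contact K (compl K c) b"
      if "\<not> time_contact K a b"
      by (rule emb.interpolation_push[OF T(1) T T time_interpolation ab that])
    show "\<exists>c\<in>elems K. \<not> time_contact K a c \<and> \<not> precedence K (compl K c) b"
      if "\<not> precedence K a b"
      by (rule emb.interpolation_push[OF P(1) T P time_precedence_interpolation ab that])
    show "\<exists>c\<in>elems K. \<not> precedence K a c \<and> \<not> time_contact K (compl K c) b"
      if "\<not> precedence K a b"
      by (rule emb.interpolation_push[OF P(1) P T precedence_time_interpolation ab that])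
  qed (rule RC_boolean RC_space_contact RC_time_contact RC_precedence)+
qed

theorem stable_subalgebra_image: "stable_subalgebra (restrict_dca K (g_map A ` elems A)) K"
proof -
  interpret emb: stable_embedding A K "g_map A"
    by (rule g_map_stable_embedding)
  have cover: "\<exists>x\<in>g_map A ` elems A. \<exists>y\<in>g_map A ` elems A. \<not> D x y \<and> below K a x \<and> below K b y"
    if st: "stable_relation (g_map A) A K C D" and ab: "a \<in> elems K" "b \<in> elems K" "\<not> D a b" for C D a b
    using emb.stable_cover[OF st ab] emb.stable_iff[OF st] by (metis imageI)
  \<comment> \<open>Reading the homomorphism equations from right to left turns operations on images
    into images, which gives closure.\<close>
  have "subalgebra (restrict_dca K (g_map A ` elems A)) K"
    by (auto simp: subalgebra_def restrict_dca_def simp flip: emb.image_simps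
        simp del: RC_simps g_map_zero g_map_one)
  moreover have "\<exists>x\<in>g_map A ` elems A. x \<noteq> zero K \<and> below K x a" if "a \<in> elems K" "a \<noteq> zero K" for a
    using emb.dense[OF that] emb.image_zero_iff by blast
  ultimately show ?thesis
    using cover[OF space_contact_stable] cover[OF time_contact_stable] cover[OF precedence_stable]
    by (simp add: stable_subalgebra_def restrict_dca_def del: RC_simps below_RC)
qed

theorem stable_isomorphic_embedding_g_map: "stable_isomorphic_embedding (g_map A) A K"
proof -
  interpret emb: stable_embedding A K "g_map A"
    by (rule g_map_stable_embedding)
  show ?thesis
    unfolding stable_isomorphic_embedding_def
    by (intro conjI ballI g_map_homomorphism inj_on_g_map stable_subalgebra_image
        emb.stable_iff[OF space_contact_stable] emb.stable_iff[OF time_contact_stable]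
        emb.stable_iff[OF precedence_stable])
qed

end

theorem theorem5p26:
  fixes A :: "'a dca"
  assumes "dynamic_contact_algebra A"
  shows "stable_subalgebra (dual_algebra (canonical_space A)) (RC (canonical_space A)) \<and>
    dynamic_contact_algebra (RC (canonical_space A)) \<and>
    stable_isomorphic_embedding (g_map A) A (RC (canonical_space A)) \<and>
    (\<forall>\<phi>. holds A \<phi> \<longleftrightarrow> holds (RC (canonical_space A)) \<phi>)"
proof -
  interpret dynamic_contact_algebra A by fact
  have "holds A \<phi> \<longleftrightarrow> holds (RC (canonical_space A)) \<phi>" for \<phi>
    by (rule stable_embedding.holds_iff[OF g_map_stable_embedding precedence_stable RC_precedence
          time_contact_stable contact_relation.axioms(1)[OF RC_time_contact]])
  \<comment> \<open>The closed base of the canonical space is the image of \<open>g_map A\<close>,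
    so the dual algebra is the subalgebra already shown stable.\<close>
  then show ?thesis
    using stable_subalgebra_image RC_dynamic_contact_algebra stable_isomorphic_embedding_g_map
    by (simp add: dual_algebra_def)
qed

end
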